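(* Let $n\in\mathbb{N}$, let $\{G_i\mid i\in I\}$ be a family of $\mathsf{GA}_n$-algebras and $Y_i=(G_i)_*$ their dual Esakia spaces. Then the coproduct of $\{G_i\mid i\in I\}$ in $\mathsf{GA}_n$ is $((\bigotimes_iY_i)_n)^*$ together with, for each $i\in I$, the map sending $a\in G_i$ to $\Box\,\pi_i^{-1}[\sigma_{G_i}(a)]\cap(\bigotimes_iY_i)_n=\{C\in(\bigotimes_iY_i)_n\mid C\subseteq \pi_i^{-1}[\sigma_{G_i}(a)]\}$.
   Context: A Gödel algebra is a Heyting algebra with $(x\to y)\vee(y\to x)=1$; with $\mathsf{bd}_0=0$, $\mathsf{bd}_n=x_n\vee(x_n\to\mathsf{bd}_{n-1})$, $\mathsf{GA}_n$ is the variety of Gödel algebras satisfying $\mathsf{bd}_n=1$. For a distributive lattice $L$, $L_*$ is the set of prime filters ordered by inclusion with topology generated by $\sigma_L(a)=\{P\mid a\in P\}$ and complements. $\prod_iY_i$ has the product topology and componentwise order, $\pi_i$ the projections. For a Priestley space $X$, $\mathsf{CC}(X)$ is the set of nonempty closed chains of $X$ with topology generated by $\Box V=\{C\mid C\subseteq V\}$, $\Diamond V=\{C\mid C\cap V\ne\varnothing\}$ ($V$ clopen) and order $C_1\unlhd C_2$ iff $C_2\subseteq C_1$ and $C_2$ is an upset of $C_1$. $\bigotimes_iY_i=\{C\in\mathsf{CC}(\prod_iY_i)\mid\pi_i[C]\text{ is an upset of }Y_i\ \forall i\}$ with induced topology and order, and $(\bigotimes_iY_i)_n$ is its subset of elements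 $C$ whose depth (cardinality of $\{K\in\bigotimes_iY_i\mid C\unlhd K\}$) is $\le n$, with induced topology and order. For an Esakia space $Y$, $Y^*$ is the Heyting algebra of its clopen upsets. *)

theory Defs
  imports "HOL-Analysis.Analysis" "HOL-Algebra.Lattice"
begin

section \<open>Heyting and Goedel algebras\<close>

text \<open>
  The lattice operations and bounds of a Heyting algebra are those HOL-Algebra derives from the
  order of the underlying \<^locale>\<open>bounded_lattice\<close>; distributivity follows from residuation.
  Algebras are not assumed to be nontrivial (\<open>\<bottom> = \<top>\<close> is allowed).
\<close>

record 'a heyting = "'a gorder" +
  imp :: "'a \<Rightarrow> 'a \<Rightarrow> 'a"  (infixr \<open>\<Rrightarrow>\<index>\<close> 60)

locale heyting_algebra = bounded_lattice H for H (structure) +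
  assumes imp_closed: "\<lbrakk>x \<in> carrier H; y \<in> carrier H\<rbrakk> \<Longrightarrow> x \<Rrightarrow> y \<in> carrier H"
    and residuation:
      "\<lbrakk>x \<in> carrier H; y \<in> carrier H; z \<in> carrier H\<rbrakk>
        \<Longrightarrow> z \<sqsubseteq> (x \<Rrightarrow> y) \<longleftrightarrow> z \<sqinter> x \<sqsubseteq> y"

locale goedel_algebra = heyting_algebra +
  assumes prelinear:
    "\<lbrakk>x \<in> carrier H; y \<in> carrier H\<rbrakk> \<Longrightarrow> (x \<Rrightarrow> y) \<squnion> (y \<Rrightarrow> x) = \<top>"

text \<open>The value of the term \<open>bd\<^sub>n\<close> under the valuation sending \<open>x\<^sub>k\<close> to \<open>x k\<close>.\<close>

primrec bd :: "'a heyting \<Rightarrow> (nat \<Rightarrow> 'a) \<Rightarrow> nat \<Rightarrow> 'a" where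
  "bd H x 0 = \<bottom>\<^bsub>H\<^esub>"
| "bd H x (Suc n) = x (Suc n) \<squnion>\<^bsub>H\<^esub> (x (Suc n) \<Rrightarrow>\<^bsub>H\<^esub> bd H x n)"

definition GA :: "nat \<Rightarrow> 'a heyting set" where
  "GA n = {H. goedel_algebra H \<and> (\<forall>x \<in> {1..n} \<rightarrow> carrier H. bd H x n = \<top>\<^bsub>H\<^esub>)}"

definition heyting_hom :: "'a heyting \<Rightarrow> 'b heyting \<Rightarrow> ('a \<Rightarrow> 'b) set" where
  "heyting_hom G H =
    {h \<in> carrier G \<rightarrow> carrier H.
       h \<bottom>\<^bsub>G\<^esub> = \<bottom>\<^bsub>H\<^esub> \<and> h \<top>\<^bsub>G\<^esub> = \<top>\<^bsub>H\<^esub> \<and>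
       (\<forall>x \<in> carrier G. \<forall>y \<in> carrier G.
          h (x \<sqinter>\<^bsub>G\<^esub> y) = h x \<sqinter>\<^bsub>H\<^esub> h y \<and>
          h (x \<squnion>\<^bsub>G\<^esub> y) = h x \<squnion>\<^bsub>H\<^esub> h y \<and>
          h (x \<Rrightarrow>\<^bsub>G\<^esub> y) = h x \<Rrightarrow>\<^bsub>H\<^esub> h y)}"

text \<open>
  Coproducts in \<open>GA n\<close>. A formula cannot quantify over types, so the universal property is tested
  on the algebras with carrier in a type \<open>'c\<close> that is a parameter; a theorem about
  \<open>is_GA_coproduct TYPE('c)\<close> with \<open>'c\<close> a type variable covers all test algebras. The condition
  \<open>h \<in> extensional (carrier K)\<close> only fixes the values of \<open>h\<close> outside the carrier, so
  that uniqueness means uniqueness as a map on \<open>carrier K\<close>.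
\<close>

definition is_GA_coproduct ::
  "'c itself \<Rightarrow> nat \<Rightarrow> 'i set \<Rightarrow> ('i \<Rightarrow> 'a heyting) \<Rightarrow> 'k heyting \<Rightarrow> ('i \<Rightarrow> 'a \<Rightarrow> 'k) \<Rightarrow> bool"
  where
  "is_GA_coproduct (_ :: 'c itself) n I G K e \<longleftrightarrow>
     K \<in> GA n \<and> (\<forall>i\<in>I. e i \<in> heyting_hom (G i) K) \<and>
     (\<forall>H \<in> (GA n :: 'c heyting set). \<forall>f. (\<forall>i\<in>I. f i \<in> heyting_hom (G i) H) \<longrightarrow>
        (\<exists>!h. h \<in> heyting_hom K H \<and> h \<in> extensional (carrier K) \<and>
              (\<forall>i\<in>I. \<forall>a \<in> carrier (G i). h (e i a) = f i a)))"

section \<open>Ordered topological spaces\<close>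

text \<open>The set of points is the \<^const>\<open>topspace\<close>; \<open>ole\<close> is only meaningful on it.\<close>

record 'x ordered_space =
  otop :: "'x topology"
  ole :: "'x \<Rightarrow> 'x \<Rightarrow> bool"

abbreviation points :: "'x ordered_space \<Rightarrow> 'x set" where
  "points X \<equiv> topspace (otop X)"

definition clopen_in :: "'x ordered_space \<Rightarrow> 'x set \<Rightarrow> bool" where
  "clopen_in X V \<longleftrightarrow> openin (otop X) V \<and> closedin (otop X) V"

definition upset_of :: "('x \<Rightarrow> 'x \<Rightarrow> bool) \<Rightarrow> 'x set \<Rightarrow> 'x set \<Rightarrow> bool" where
  "upset_of r A U \<longleftrightarrow> U \<subseteq> A \<and> (\<forall>x\<in>U. \<forall>y\<in>A. r x y \<longrightarrow> y \<in> U)"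

definition ordered_subspace :: "'x ordered_space \<Rightarrow> 'x set \<Rightarrow> 'x ordered_space" where
  "ordered_subspace X S = \<lparr>otop = subtopology (otop X) S, ole = ole X\<rparr>"

definition ordered_product :: "'i set \<Rightarrow> ('i \<Rightarrow> 'x ordered_space) \<Rightarrow> ('i \<Rightarrow> 'x) ordered_space" where
  "ordered_product I Y =
    \<lparr>otop = product_topology (\<lambda>i. otop (Y i)) I,
     ole = (\<lambda>x y. \<forall>i\<in>I. ole (Y i) (x i) (y i))\<rparr>"

section \<open>Duality\<close>

definition prime_filter :: "('a, 'm) gorder_scheme \<Rightarrow> 'a set \<Rightarrow> bool" where
  "prime_filter L P \<longleftrightarrow>
     P \<subseteq> carrier L \<and> P \<noteq> {} \<and> P \<noteq> carrier L \<and>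
     (\<forall>x\<in>P. \<forall>y\<in>carrier L. x \<sqsubseteq>\<^bsub>L\<^esub> y \<longrightarrow> y \<in> P) \<and>
     (\<forall>x\<in>P. \<forall>y\<in>P. x \<sqinter>\<^bsub>L\<^esub> y \<in> P) \<and>
     (\<forall>x\<in>carrier L. \<forall>y\<in>carrier L. x \<squnion>\<^bsub>L\<^esub> y \<in> P \<longrightarrow> x \<in> P \<or> y \<in> P)"

definition stone_map :: "('a, 'm) gorder_scheme \<Rightarrow> 'a \<Rightarrow> 'a set set" where
  "stone_map L a = {P. prime_filter L P \<and> a \<in> P}"

definition dual_space :: "('a, 'm) gorder_scheme \<Rightarrow> 'a set ordered_space" where
  "dual_space L =
    \<lparr>otop = topology_generated_by
       ({stone_map L a | a. a \<in> carrier L} \<union> {{P. prime_filter L P} - stone_map L a | a. a \<in> carrier L}),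
     ole = (\<subseteq>)\<rparr>"

text \<open>The implication of the dual algebra of \<open>Y\<close> is \<open>U \<Rrightarrow> V = Y - \<down>(U - V)\<close>.\<close>

definition dual_algebra :: "'x ordered_space \<Rightarrow> 'x set heyting" where
  "dual_algebra Y =
    \<lparr>carrier = {U. clopen_in Y U \<and> upset_of (ole Y) (points Y) U},
     eq = (=),
     le = (\<subseteq>),
     imp = (\<lambda>U V. points Y - {x \<in> points Y. \<exists>y \<in> U - V. ole Y x y})\<rparr>"

section \<open>Spaces of closed chains\<close>

definition closed_chains :: "'x ordered_space \<Rightarrow> 'x set set" where
  "closed_chains X =
    {C. C \<noteq> {} \<and> closedin (otop X) C \<and> Complete_Partial_Order.chain (ole X) C}"

definition chain_box :: "'x ordered_space \<Rightarrow> 'x set \<Rightarrow> 'x set set" where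
  "chain_box X V = {C \<in> closed_chains X. C \<subseteq> V}"

definition chain_diamond :: "'x ordered_space \<Rightarrow> 'x set \<Rightarrow> 'x set set" where
  "chain_diamond X V = {C \<in> closed_chains X. C \<inter> V \<noteq> {}}"

definition CC :: "'x ordered_space \<Rightarrow> 'x set ordered_space" where
  "CC X =
    \<lparr>otop = topology_generated_by
       ({chain_box X V | V. clopen_in X V} \<union> {chain_diamond X V | V. clopen_in X V}),
     ole = (\<lambda>C\<^sub>1 C\<^sub>2. upset_of (ole X) C\<^sub>1 C\<^sub>2)\<rparr>"

definition tensor :: "'i set \<Rightarrow> ('i \<Rightarrow> 'x ordered_space) \<Rightarrow> ('i \<Rightarrow> 'x) set ordered_space" where
  "tensor I Y =
    ordered_subspace (CC (ordered_product I Y))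
      {C \<in> closed_chains (ordered_product I Y).
         \<forall>i\<in>I. upset_of (ole (Y i)) (points (Y i)) ((\<lambda>y. y i) ` C)}"

text \<open>Finiteness is required explicitly because \<^const>\<open>card\<close> is \<open>0\<close> on infinite sets.\<close>

definition depth_le :: "'x ordered_space \<Rightarrow> nat \<Rightarrow> 'x \<Rightarrow> bool" where
  "depth_le X n x \<longleftrightarrow> finite {y \<in> points X. ole X x y} \<and> card {y \<in> points X. ole X x y} \<le> n"

definition tensor_depth ::
  "nat \<Rightarrow> 'i set \<Rightarrow> ('i \<Rightarrow> 'x ordered_space) \<Rightarrow> ('i \<Rightarrow> 'x) set ordered_space" where
  "tensor_depth n I Y =
    ordered_subspace (tensor I Y) {C \<in> points (tensor I Y). depth_le (tensor I Y) n C}"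

definition coproduct_map ::
  "nat \<Rightarrow> 'i set \<Rightarrow> ('i \<Rightarrow> 'a heyting) \<Rightarrow> 'i \<Rightarrow> 'a \<Rightarrow> ('i \<Rightarrow> 'a set) set set" where
  "coproduct_map n I G i a =
    (let Y = (\<lambda>i. dual_space (G i)); X = ordered_product I Y
     in chain_box X {y \<in> points X. y i \<in> stone_map (G i) a} \<inter> points (tensor_depth n I Y))"

end

theory Submission
  imports Defs
begin

text \<open>
  The points of \<open>(\<Otimes> Y\<^sub>i)\<^sub>n\<close> are the finite chains of at most \<open>n\<close> points of \<open>\<Prod> Y\<^sub>i\<close> whose projections are
  upsets, and a point above \<open>C\<close> is the part of \<open>C\<close> above one of its elements. The sorted
  \<open>n\<close>-tuples enumerating such chains form a closed subset of a power of \<open>\<Prod> Y\<^sub>i\<close>, and enumeration is a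
  quotient map onto \<open>(\<Otimes> Y\<^sub>i)\<^sub>n\<close>; hence this space is compact, and downsets of clopen sets are
  clopen because the tails of a tuple depend continuously on it.

  Given homomorphisms \<open>f\<^sub>i\<close> into a test algebra \<open>H\<close>, a prime filter \<open>z\<close> of \<open>H\<close> has at most \<open>n\<close> prime
  filters above it, and they form a chain. Sending \<open>z\<close> to the set of all \<open>(f\<^sub>i\<^sup>-\<^sup>1[w])\<^sub>i\<close> with
  \<open>z \<subseteq> w\<close> is a continuous p-morphism into \<open>(\<Otimes> Y\<^sub>i)\<^sub>n\<close>, and the mediating homomorphism is its inverse
  image map. It is unique because a finite chain consists of the least elements of its nonempty
  upsets, and these are detected by the coprojections.
\<close>

section \<open>Prime filters\<close>

text \<open>The depth bound is what tames the hyperspace of chains. With at most \<open>n\<close>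
  points, compactness comes from a finite power of the compact space \<open>X\<close>. A quantifier
  over the points of a chain turns into one over finitely many coordinates, and then existential
  conditions preserve closedness just as universal ones do.

  The number \<open>n\<close> enters from both sides. In a test algebra, \<open>bd\<close> being
  valid at level \<open>n\<close> limits every prime filter to \<open>n\<close> prime filters above
  it, so the chains built from the algebra fit into the space. In the coproduct, every step strictly
  upward from a chain loses at least one of its points, so \<open>bd\<close> is exhausted after
  \<open>n\<close> levels.

  The obstacle to uniqueness is that the coprojections see only the least point of a chain. The
  other points are recovered by lifting prime filters along the given homomorphism: each tail of the
  chain belongs to a larger prime filter of the test algebra, and the least point of that tail is
  visible there. Equality of elements and the laws of the mediating homomorphism are all checked at
  the prime filters of the test algebra, which separate its elements.\<close>

context heyting_algebra
begin

\<comment> \<open>As introduction rules these apply to every equation and make the classical reasoner loop.\<close>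
declare le_antisym [rule del] weak_le_antisym [rule del] le_refl [rule del] weak_refl [rule del]
  Upper_elemD [rule del] lless_antisym [rule del]

text \<open>The improper filter is allowed, so that adjoining elements never leads out of this
  notion; properness is obtained later from disjointness with a nonempty ideal.\<close>

definition filter_in :: "'a set \<Rightarrow> bool" where
  "filter_in F \<longleftrightarrow> F \<subseteq> carrier H \<and> F \<noteq> {} \<and> (\<forall>x\<in>F. \<forall>y\<in>carrier H. x \<sqsubseteq> y \<longrightarrow> y \<in> F) \<and>
     (\<forall>x\<in>F. \<forall>y\<in>F. x \<sqinter> y \<in> F)"

definition ideal_in :: "'a set \<Rightarrow> bool" where
  "ideal_in J \<longleftrightarrow> J \<subseteq> carrier H \<and> J \<noteq> {} \<and> (\<forall>x\<in>J. \<forall>y\<in>carrier H. y \<sqsubseteq> x \<longrightarrow> y \<in> J) \<and>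
     (\<forall>x\<in>J. \<forall>y\<in>J. x \<squnion> y \<in> J)"

lemma filter_inD:
  assumes "filter_in F"
  shows "F \<subseteq> carrier H" "F \<noteq> {}" "\<And>x y. x \<in> F \<Longrightarrow> y \<in> carrier H \<Longrightarrow> x \<sqsubseteq> y \<Longrightarrow> y \<in> F"
    "\<And>x y. x \<in> F \<Longrightarrow> y \<in> F \<Longrightarrow> x \<sqinter> y \<in> F"
  using assms unfolding filter_in_def by blast+

lemma ideal_inD:
  assumes "ideal_in J"
  shows "J \<subseteq> carrier H" "J \<noteq> {}" "\<And>x y. x \<in> J \<Longrightarrow> y \<in> carrier H \<Longrightarrow> y \<sqsubseteq> x \<Longrightarrow> y \<in> J"
    "\<And>x y. x \<in> J \<Longrightarrow> y \<in> J \<Longrightarrow> x \<squnion> y \<in> J"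
  using assms unfolding ideal_in_def by blast+

lemma meet_mono:
  assumes "x \<sqsubseteq> x'" "y \<sqsubseteq> y'" "x \<in> carrier H" "x' \<in> carrier H" "y \<in> carrier H" "y' \<in> carrier H"
  shows "x \<sqinter> y \<sqsubseteq> x' \<sqinter> y'"
proof -
  have "x \<sqinter> y \<sqsubseteq> x'" "x \<sqinter> y \<sqsubseteq> y'"
    using assms le_trans meet_left meet_right meet_closed by meson+
  then show ?thesis
    using assms meet_le by simp
qed

lemma join_mono:
  assumes "x \<sqsubseteq> x'" "y \<sqsubseteq> y'" "x \<in> carrier H" "x' \<in> carrier H" "y \<in> carrier H" "y' \<in> carrier H"
  shows "x \<squnion> y \<sqsubseteq> x' \<squnion> y'"
proof -
  have "x \<sqsubseteq> x' \<squnion> y'" "y \<sqsubseteq> x' \<squnion> y'"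
    using assms le_trans join_left join_right join_closed by meson+
  then show ?thesis
    using assms join_le by simp
qed

lemma modus_ponens:
  assumes "x \<in> carrier H" "y \<in> carrier H"
  shows "(x \<Rrightarrow> y) \<sqinter> x \<sqsubseteq> y"
  using residuation[of x y "x \<Rrightarrow> y"] assms imp_closed by simp

lemma meet_singleton:
  assumes "a \<in> carrier H" "x \<in> {a}" "y \<in> {a}"
  shows "x \<sqinter> y \<in> {a}"
  using assms le_iff_join[of a a] by simp

lemma filter_principal:
  assumes "a \<in> carrier H"
  shows "filter_in {z \<in> carrier H. a \<sqsubseteq> z}"
  using assms unfolding filter_in_def by (auto intro: le_trans meet_le)

lemma ideal_principal:
  assumes "b \<in> carrier H"
  shows "ideal_in {z \<in> carrier H. z \<sqsubseteq> b}"
  using assms unfolding ideal_in_def by (auto intro: le_trans join_le)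

text \<open>The generated set is closed under meets because
  \<open>(p \<sqinter> p') \<sqinter> (q \<sqinter> q')\<close> lies below both
  \<open>p \<sqinter> q\<close> and \<open>p' \<sqinter> q'\<close>. From \<open>Q\<close> only
  closure under meets is asked, so it can be a singleton or the image of a prime filter under a
  homomorphism.\<close>

lemma filter_adjoin:
  assumes P: "filter_in P" and Q: "Q \<subseteq> carrier H" "Q \<noteq> {}"
    and meet: "\<And>x y. x \<in> Q \<Longrightarrow> y \<in> Q \<Longrightarrow> x \<sqinter> y \<in> Q"
  defines "F \<equiv> {z \<in> carrier H. \<exists>p\<in>P. \<exists>q\<in>Q. p \<sqinter> q \<sqsubseteq> z}"
  shows "filter_in F" "P \<subseteq> F" "Q \<subseteq> F"
proof -
  note P' = filter_inD[OF P]
  obtain p0 q0 where p0: "p0 \<in> P" and q0: "q0 \<in> Q"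
    using P' Q by blast
  show PF: "P \<subseteq> F"
    unfolding F_def using P'(1) Q(1) q0 meet_left by blast
  show "Q \<subseteq> F"
    unfolding F_def using P'(1) Q(1) p0 meet_right by blast
  show "filter_in F"
    unfolding filter_in_def
  proof (intro conjI ballI impI)
    show "F \<subseteq> carrier H" "F \<noteq> {}"
      using PF p0 by (auto simp: F_def)
    fix x y assume x: "x \<in> F"
    { assume "y \<in> carrier H" "x \<sqsubseteq> y"
      moreover obtain p q where "p \<in> P" "q \<in> Q" "p \<sqinter> q \<sqsubseteq> x" "x \<in> carrier H"
        using x unfolding F_def by auto
      moreover from this have "p \<in> carrier H" "q \<in> carrier H"
        using P' Q by auto
      ultimately show "y \<in> F"
        unfolding F_def using le_trans[of "p \<sqinter> q" x y] by auto }
    assume y: "y \<in> F"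
    from x obtain p q where pq: "p \<in> P" "q \<in> Q" "p \<sqinter> q \<sqsubseteq> x" and xc: "x \<in> carrier H"
      unfolding F_def by auto
    from y obtain p' q' where pq': "p' \<in> P" "q' \<in> Q" "p' \<sqinter> q' \<sqsubseteq> y" and yc: "y \<in> carrier H"
      unfolding F_def by auto
    have c: "p \<in> carrier H" "p' \<in> carrier H" "q \<in> carrier H" "q' \<in> carrier H"
      using pq pq' P' Q by auto
    have "(p \<sqinter> p') \<sqinter> (q \<sqinter> q') \<sqsubseteq> p \<sqinter> q" "(p \<sqinter> p') \<sqinter> (q \<sqinter> q') \<sqsubseteq> p' \<sqinter> q'"
      using c meet_mono meet_left meet_right by auto
    then have "(p \<sqinter> p') \<sqinter> (q \<sqinter> q') \<sqsubseteq> x \<sqinter> y"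
      using c pq pq' xc yc by (meson le_trans meet_closed meet_le)
    then show "x \<sqinter> y \<in> F"
      unfolding F_def using xc yc P'(4)[OF pq(1) pq'(1)] meet[OF pq(2) pq'(2)] by auto
  qed
qed

text \<open>Zorn's lemma gives a filter \<open>P\<close> maximal among those that contain
  \<open>F\<close> and miss \<open>J\<close>. If neither \<open>x\<close> nor \<open>y\<close> is in
  \<open>P\<close>, adjoining either one must hit \<open>J\<close>; residuation, standing in for
  distributivity, then keeps \<open>x \<squnion> y\<close> out of \<open>P\<close> as well.\<close>

lemma prime_filter_theorem:
  assumes F: "filter_in F" and J: "ideal_in J" and FJ: "F \<inter> J = {}"
  obtains P where "prime_filter H P" "F \<subseteq> P" "P \<inter> J = {}"
proof -
  define A where "A = {P. filter_in P \<and> F \<subseteq> P \<and> P \<inter> J = {}}"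
  note J' = ideal_inD[OF J]
  have "\<exists>M\<in>A. \<forall>X\<in>A. M \<subseteq> X \<longrightarrow> X = M"
  proof (rule subset_Zorn_nonempty)
    show "A \<noteq> {}"
      using F FJ by (auto simp: A_def)
    fix C assume C0: "C \<noteq> {}" and C: "subset.chain A C"
    then have C': "\<And>P. P \<in> C \<Longrightarrow> filter_in P \<and> F \<subseteq> P \<and> P \<inter> J = {}"
      and tot: "\<And>P Q. P \<in> C \<Longrightarrow> Q \<in> C \<Longrightarrow> P \<subseteq> Q \<or> Q \<subseteq> P"
      using C unfolding subset_chain_def A_def by blast+
    have "filter_in (\<Union>C)"
      unfolding filter_in_def
    proof (intro conjI ballI impI)
      show "\<Union>C \<subseteq> carrier H" "\<Union>C \<noteq> {}"
        using C' C0 filter_inD(1,2) by (blast, metis Sup_bot_conv(1) equals0I)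
      fix x y assume x: "x \<in> \<Union>C"
      { assume "y \<in> carrier H" "x \<sqsubseteq> y"
        with x C' show "y \<in> \<Union>C"
          using filter_inD(3) by blast }
      assume "y \<in> \<Union>C"
      with x obtain P where "P \<in> C" "x \<in> P" "y \<in> P"
        using tot by blast
      then show "x \<sqinter> y \<in> \<Union>C"
        using C' filter_inD(4) by blast
    qed
    then show "\<Union>C \<in> A"
      unfolding A_def using C' C0 by blast
  qed
  then obtain P where P: "filter_in P" "F \<subseteq> P" "P \<inter> J = {}"
    and max: "\<And>X. filter_in X \<Longrightarrow> P \<subseteq> X \<Longrightarrow> X \<inter> J = {} \<Longrightarrow> X = P"
    by (auto simp: A_def)
  note P' = filter_inD[OF P(1)]
  have meets: "\<exists>p\<in>P. \<exists>j\<in>J. p \<sqinter> x \<sqsubseteq> j" if x: "x \<in> carrier H" "x \<notin> P" for x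
  proof -
    have ad: "filter_in {z \<in> carrier H. \<exists>p\<in>P. \<exists>q\<in>{x}. p \<sqinter> q \<sqsubseteq> z}"
      "P \<subseteq> {z \<in> carrier H. \<exists>p\<in>P. \<exists>q\<in>{x}. p \<sqinter> q \<sqsubseteq> z}"
      "{x} \<subseteq> {z \<in> carrier H. \<exists>p\<in>P. \<exists>q\<in>{x}. p \<sqinter> q \<sqsubseteq> z}"
      using filter_adjoin[OF P(1) _ _ meet_singleton[OF x(1)]] x(1) by auto
    then show ?thesis
      using max[OF ad(1,2)] x(2) by blast
  qed
  have "prime_filter H P"
    unfolding prime_filter_def
  proof (intro conjI ballI impI)
    show "P \<noteq> carrier H"
      using P(3) J' by blast
    fix x y assume xy: "x \<in> carrier H" "y \<in> carrier H" "x \<squnion> y \<in> P"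
    show "x \<in> P \<or> y \<in> P"
    proof (rule ccontr)
      assume "\<not> (x \<in> P \<or> y \<in> P)"
      then obtain p j q k where pq: "p \<in> P" "j \<in> J" "p \<sqinter> x \<sqsubseteq> j" "q \<in> P" "k \<in> J" "q \<sqinter> y \<sqsubseteq> k"
        using meets xy by meson
      define r where "r = p \<sqinter> q"
      define m where "m = j \<squnion> k"
      have r: "r \<in> P" and m: "m \<in> J"
        using P'(4)[OF pq(1,4)] J'(4)[OF pq(2,5)] by (auto simp: r_def m_def)
      have c: "p \<in> carrier H" "q \<in> carrier H" "r \<in> carrier H" "j \<in> carrier H" "k \<in> carrier H" "m \<in> carrier H"
        using pq P'(1) J'(1) r m by auto
      have rp: "r \<sqsubseteq> p" "r \<sqsubseteq> q" and jm: "j \<sqsubseteq> m" "k \<sqsubseteq> m"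
        using c by (auto simp: r_def m_def meet_left meet_right join_left join_right)
      have "x \<sqinter> r \<sqsubseteq> p \<sqinter> x" "y \<sqinter> r \<sqsubseteq> q \<sqinter> y"
        using c rp xy meet_comm[of H] by (metis le_refl meet_mono)+
      then have "x \<sqinter> r \<sqsubseteq> m" "y \<sqinter> r \<sqsubseteq> m"
        using pq c xy jm by (meson le_trans meet_closed)+
      then have "x \<sqsubseteq> r \<Rrightarrow> m" "y \<sqsubseteq> r \<Rrightarrow> m"
        using residuation c xy by auto
      then have "x \<squnion> y \<sqsubseteq> r \<Rrightarrow> m"
        using c xy join_le imp_closed by auto
      then have "(x \<squnion> y) \<sqinter> r \<sqsubseteq> m"
        using residuation c xy by auto
      then have "m \<in> P"
        using P'(3)[OF P'(4)[OF xy(3) r] c(6)] by simp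
      then show False
        using m P(3) by blast
    qed
  qed (use P' in auto)
  then show thesis
    using that P by blast
qed

lemma prime_filterD:
  assumes "prime_filter H P"
  shows "P \<subseteq> carrier H" "\<top> \<in> P" "\<bottom> \<notin> P"
    "\<And>x y. x \<in> P \<Longrightarrow> y \<in> carrier H \<Longrightarrow> x \<sqsubseteq> y \<Longrightarrow> y \<in> P"
    "\<And>x y. x \<in> carrier H \<Longrightarrow> y \<in> carrier H \<Longrightarrow> x \<sqinter> y \<in> P \<longleftrightarrow> x \<in> P \<and> y \<in> P"
    "\<And>x y. x \<in> carrier H \<Longrightarrow> y \<in> carrier H \<Longrightarrow> x \<squnion> y \<in> P \<longleftrightarrow> x \<in> P \<or> y \<in> P"
    "filter_in P"
proof -
  have P: "P \<subseteq> carrier H" "P \<noteq> {}" "P \<noteq> carrier H"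
    and up: "\<And>x y. x \<in> P \<Longrightarrow> y \<in> carrier H \<Longrightarrow> x \<sqsubseteq> y \<Longrightarrow> y \<in> P"
    and meet: "\<And>x y. x \<in> P \<Longrightarrow> y \<in> P \<Longrightarrow> x \<sqinter> y \<in> P"
    and prime: "\<And>x y. x \<in> carrier H \<Longrightarrow> y \<in> carrier H \<Longrightarrow> x \<squnion> y \<in> P \<Longrightarrow> x \<in> P \<or> y \<in> P"
    using assms unfolding prime_filter_def by auto
  show "P \<subseteq> carrier H" "\<And>x y. x \<in> P \<Longrightarrow> y \<in> carrier H \<Longrightarrow> x \<sqsubseteq> y \<Longrightarrow> y \<in> P"
    using P up by auto
  show "filter_in P"
    unfolding filter_in_def using P up meet by blast
  show "\<top> \<in> P" "\<bottom> \<notin> P"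
  proof -
    obtain p q where "p \<in> P" "q \<in> carrier H" "q \<notin> P"
      using P by blast
    then show "\<top> \<in> P" "\<bottom> \<notin> P"
      using P up[of p "\<top>"] up[of "\<bottom>" q] by auto
  qed
  show "x \<sqinter> y \<in> P \<longleftrightarrow> x \<in> P \<and> y \<in> P" if "x \<in> carrier H" "y \<in> carrier H" for x y
    using that up[OF _ that(1) meet_left[OF that]] up[OF _ that(2) meet_right[OF that]] meet by blast
  show "x \<squnion> y \<in> P \<longleftrightarrow> x \<in> P \<or> y \<in> P" if "x \<in> carrier H" "y \<in> carrier H" for x y
    using up[OF _ join_closed join_left] up[OF _ join_closed join_right] prime that by blast
qed

lemma prime_filter_separation:
  assumes "a \<in> carrier H" "b \<in> carrier H" "\<not> a \<sqsubseteq> b"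
  obtains P where "prime_filter H P" "a \<in> P" "b \<notin> P"
proof -
  have "{z \<in> carrier H. a \<sqsubseteq> z} \<inter> {z \<in> carrier H. z \<sqsubseteq> b} = {}"
    using assms le_trans by blast
  then obtain P where P: "prime_filter H P" "{z \<in> carrier H. a \<sqsubseteq> z} \<subseteq> P"
    "P \<inter> {z \<in> carrier H. z \<sqsubseteq> b} = {}"
    by (rule prime_filter_theorem[OF filter_principal[OF assms(1)] ideal_principal[OF assms(2)]])
  show thesis
    by (rule that[OF P(1)]) (use P(2,3) assms in auto)
qed

text \<open>The filter generated by \<open>P\<close> and \<open>a\<close> misses the ideal below
  \<open>b\<close>, since \<open>p \<sqinter> a \<sqsubseteq> b\<close> with \<open>p\<close> in
  \<open>P\<close> would put \<open>a \<Rrightarrow> b\<close> above \<open>p\<close>.\<close>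

lemma imp_notin_prime_filter:
  assumes P: "prime_filter H P" and ab: "a \<in> carrier H" "b \<in> carrier H" and ni: "(a \<Rrightarrow> b) \<notin> P"
  obtains Q where "prime_filter H Q" "P \<subseteq> Q" "a \<in> Q" "b \<notin> Q"
proof -
  note P' = prime_filterD[OF P]
  let ?F = "{z \<in> carrier H. \<exists>p\<in>P. \<exists>q\<in>{a}. p \<sqinter> q \<sqsubseteq> z}"
  have F: "filter_in ?F" "P \<subseteq> ?F" "{a} \<subseteq> ?F"
    using filter_adjoin[OF P'(7) _ _ meet_singleton[OF ab(1)]] ab(1) by auto
  have "?F \<inter> {z \<in> carrier H. z \<sqsubseteq> b} = {}"
  proof (rule ccontr)
    assume "\<not> ?thesis"
    then obtain z p where z: "z \<in> carrier H" "p \<in> P" "p \<sqinter> a \<sqsubseteq> z" "z \<sqsubseteq> b"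
      by auto
    then have "p \<sqinter> a \<sqsubseteq> b"
      using P' ab by (meson le_trans meet_closed subsetD)
    then have "p \<sqsubseteq> a \<Rrightarrow> b"
      using residuation[of a b p] ab z(2) P'(1) by auto
    then show False
      using ni P'(4)[OF z(2)] ab imp_closed by auto
  qed
  then obtain Q where Q: "prime_filter H Q" "?F \<subseteq> Q" "Q \<inter> {z \<in> carrier H. z \<sqsubseteq> b} = {}"
    by (rule prime_filter_theorem[OF F(1) ideal_principal[OF ab(2)]])
  show thesis
  proof (rule that[OF Q(1)])
    show "P \<subseteq> Q" "a \<in> Q"
      using F(2,3) Q(2) by (meson subset_trans insert_subset)+
    show "b \<notin> Q"
      using Q(3) ab(2) by auto
  qed
qed

lemma imp_in_prime_filter:
  assumes P: "prime_filter H P" and ab: "a \<in> carrier H" "b \<in> carrier H"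
  shows "(a \<Rrightarrow> b) \<in> P \<longleftrightarrow> (\<forall>Q. prime_filter H Q \<longrightarrow> P \<subseteq> Q \<longrightarrow> a \<in> Q \<longrightarrow> b \<in> Q)"
proof
  assume i: "(a \<Rrightarrow> b) \<in> P"
  show "\<forall>Q. prime_filter H Q \<longrightarrow> P \<subseteq> Q \<longrightarrow> a \<in> Q \<longrightarrow> b \<in> Q"
  proof (intro allI impI)
    fix Q assume Q: "prime_filter H Q" "P \<subseteq> Q" "a \<in> Q"
    then have "(a \<Rrightarrow> b) \<sqinter> a \<in> Q"
      using i prime_filterD(5)[OF Q(1), of "a \<Rrightarrow> b" a] ab imp_closed by blast
    then show "b \<in> Q"
      using modus_ponens ab prime_filterD(4)[OF Q(1)] by blast
  qed
qed (use imp_notin_prime_filter[OF P ab] in blast)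

text \<open>The element is specified by the prime filters that contain it, and later arguments work
  with this description instead of an iterated meet. The empty set gives the top element.\<close>

lemma finite_meet:
  assumes "finite A" "A \<subseteq> carrier H"
  obtains u where "u \<in> carrier H" "\<And>P. prime_filter H P \<Longrightarrow> u \<in> P \<longleftrightarrow> A \<subseteq> P"
proof -
  have "\<exists>u\<in>carrier H. \<forall>P. prime_filter H P \<longrightarrow> (u \<in> P \<longleftrightarrow> A \<subseteq> P)"
    using assms
  proof (induction A)
    case empty
    then show ?case
      using prime_filterD(2) top_closed by blast
  next
    case (insert a A)
    then obtain u where "u\<in>carrier H" "\<forall>P. prime_filter H P \<longrightarrow> (u \<in> P \<longleftrightarrow> A \<subseteq> P)"
      by auto
    then show ?case
      using insert.prems prime_filterD(5) by (intro bexI[of _ "a \<sqinter> u"]) auto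
  qed
  then show thesis
    using that by blast
qed

lemma finite_join:
  assumes "finite A" "A \<subseteq> carrier H"
  obtains u where "u \<in> carrier H" "\<And>P. prime_filter H P \<Longrightarrow> u \<in> P \<longleftrightarrow> A \<inter> P \<noteq> {}"
proof -
  have "\<exists>u\<in>carrier H. \<forall>P. prime_filter H P \<longrightarrow> (u \<in> P \<longleftrightarrow> A \<inter> P \<noteq> {})"
    using assms
  proof (induction A)
    case empty
    then show ?case
      using prime_filterD(3) bottom_closed by blast
  next
    case (insert a A)
    then obtain u where "u\<in>carrier H" "\<forall>P. prime_filter H P \<longrightarrow> (u \<in> P \<longleftrightarrow> A \<inter> P \<noteq> {})"
      by auto
    then show ?case
      using insert.prems prime_filterD(6) by (intro bexI[of _ "a \<squnion> u"]) auto
  qed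
  then show thesis
    using that by blast
qed

text \<open>The prime filters containing \<open>a\<close> and omitting \<open>b\<close> form a basic
  clopen set, so this is a basic neighbourhood of \<open>Q\<close> that misses \<open>F\<close>. An
  element separating \<open>Q\<close> from one further filter is absorbed into \<open>a\<close> by a
  meet if it belongs to \<open>Q\<close>, and into \<open>b\<close> by a join otherwise.\<close>

lemma finite_separation:
  assumes "finite F" "\<And>P. P \<in> F \<Longrightarrow> prime_filter H P" "prime_filter H Q" "Q \<notin> F"
  obtains a b where "a \<in> Q" "b \<in> carrier H - Q" "\<And>P. P \<in> F \<Longrightarrow> a \<in> P \<Longrightarrow> b \<in> P"
proof -
  have "\<exists>a\<in>Q. \<exists>b\<in>carrier H - Q. \<forall>P\<in>F. a \<in> P \<longrightarrow> b \<in> P"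
    using assms
  proof (induction F)
    case empty
    then show ?case
      using prime_filterD bottom_closed by blast
  next
    case (insert P F)
    then obtain a b where ab: "a \<in> Q" "b \<in> carrier H - Q" "\<forall>P\<in>F. a \<in> P \<longrightarrow> b \<in> P"
      by auto
    note Q = prime_filterD[OF insert.prems(2)]
    have pr: "prime_filter H R" if "R \<in> insert P F" for R
      using insert.prems that by auto
    consider c where "c \<in> Q" "c \<notin> P" | c where "c \<in> P" "c \<notin> Q"
      using insert.prems by blast
    then show ?case
    proof cases
      case 1
      moreover have "a \<in> carrier H" "c \<in> carrier H"
        using 1 ab Q(1) by auto
      ultimately have "a \<sqinter> c \<in> Q" "\<forall>R\<in>insert P F. a \<sqinter> c \<in> R \<longrightarrow> b \<in> R"
        using ab Q(5)[of a c] prime_filterD(5)[OF pr, of _ a c] by auto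
      then show ?thesis
        using ab by blast
    next
      case 2
      have "c \<in> carrier H"
        using 2(1) pr[of P] prime_filterD(1) by auto
      then have "b \<squnion> c \<in> carrier H - Q" "\<forall>R\<in>insert P F. a \<in> R \<longrightarrow> b \<squnion> c \<in> R"
        using ab 2 Q(6)[of b c] prime_filterD(6)[OF pr, of _ b c] by auto
      then show ?thesis
        using ab by blast
    qed
  qed
  then show thesis
    using that by blast
qed

end

section \<open>Dual spaces\<close>

text \<open>Alexander's subbase theorem speaks of the left-hand form of the topology, while dual
  spaces are defined by the right-hand one. Both inclusions come from the minimality of a topology
  generated by a subbase.\<close>

lemma topology_generated_by_subbase:
  "topology (arbitrary union_of (finite intersection_of (\<lambda>x. x \<in> B) relative_to \<Union>B))
     = topology_generated_by B" (is "?T = _")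
proof -
  have U: "openin (topology_generated_by B) (\<Union>B)"
    by (metis openin_topspace topology_generated_by_topspace)
  have "openin ?T V \<longleftrightarrow> openin (topology_generated_by B) V" for V
  proof
    show "openin (topology_generated_by B) V" if "openin ?T V"
      using minimal_topology_subbase[OF _ U that] by (simp add: topology_generated_by_Basis)
    show "openin ?T V" if "openin (topology_generated_by B) V"
    proof (rule generate_topology_on_coarsest[of "openin ?T" B])
      show "openin ?T S" if "S \<in> B" for S
        unfolding openin_subbase using that
        by (intro arbitrary_union_of_inc relative_to_subset_inc finite_intersection_of_inc) auto
    qed (use that in \<open>auto simp: openin_topology_generated_by_iff\<close>)
  qed
  then show ?thesis
    by (simp add: topology_eq)
qed

context heyting_algebra
begin

lemma points_dual_space: "points (dual_space H) = {P. prime_filter H P}"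
  using top_closed unfolding dual_space_def stone_map_def by auto

lemma ole_dual_space [simp]: "ole (dual_space H) = (\<subseteq>)"
  by (simp add: dual_space_def)

lemma stone_map_compl:
  "{P. prime_filter H P} - stone_map H a = {P. prime_filter H P \<and> a \<notin> P}"
  by (auto simp: stone_map_def)

lemma openin_stone_map:
  assumes "a \<in> carrier H"
  shows "openin (otop (dual_space H)) (stone_map H a)"
    "openin (otop (dual_space H)) {P. prime_filter H P \<and> a \<notin> P}"
  using assms unfolding dual_space_def stone_map_compl
  by (auto intro!: topology_generated_by_Basis)

lemma clopen_stone_map:
  assumes "a \<in> carrier H"
  shows "clopen_in (dual_space H) (stone_map H a)"
  using openin_stone_map[OF assms]
  by (auto simp: clopen_in_def closedin_def points_dual_space stone_map_compl)
     (auto simp: stone_map_def)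

text \<open>The neighbourhoods given by the pairs \<open>a\<close>, \<open>b\<close> and
  \<open>c\<close>, \<open>d\<close> intersect in the one given by \<open>a \<sqinter> c\<close> and
  \<open>b \<squnion> d\<close>, so the subbase already yields a base indexed by pairs.\<close>

lemma dual_space_base:
  assumes "openin (otop (dual_space H)) U" "P \<in> U"
  obtains a b where "a \<in> P" "b \<in> carrier H - P" "\<And>Q. prime_filter H Q \<Longrightarrow> a \<in> Q \<Longrightarrow> b \<notin> Q \<Longrightarrow> Q \<in> U"
proof -
  have PP: "prime_filter H P"
    using assms openin_subset points_dual_space by fastforce
  note P = prime_filterD[OF PP]
  let ?B = "{stone_map H a | a. a \<in> carrier H} \<union> {{P. prime_filter H P} - stone_map H a | a. a \<in> carrier H}"
  have "generate_topology_on ?B U"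
    using assms by (simp add: dual_space_def openin_topology_generated_by_iff)
  then have "P \<in> U \<longrightarrow> (\<exists>a\<in>P. \<exists>b\<in>carrier H - P. \<forall>Q. prime_filter H Q \<longrightarrow> a \<in> Q \<longrightarrow> b \<notin> Q \<longrightarrow> Q \<in> U)"
  proof (induction rule: generate_topology_on.induct)
    case (Int U V)
    show ?case
    proof
      assume "P \<in> U \<inter> V"
      then obtain a b c d where ab: "a \<in> P" "b \<in> carrier H - P" "\<forall>Q. prime_filter H Q \<longrightarrow> a \<in> Q \<longrightarrow> b \<notin> Q \<longrightarrow> Q \<in> U"
        and cd: "c \<in> P" "d \<in> carrier H - P" "\<forall>Q. prime_filter H Q \<longrightarrow> c \<in> Q \<longrightarrow> d \<notin> Q \<longrightarrow> Q \<in> V"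
        using Int.IH by auto
      have "a \<sqinter> c \<in> P" "b \<squnion> d \<in> carrier H - P"
        using ab(1,2) cd(1,2) P(1) P(5)[of a c] P(6)[of b d] by auto
      moreover have "Q \<in> U \<inter> V" if "prime_filter H Q" "a \<sqinter> c \<in> Q" "b \<squnion> d \<notin> Q" for Q
        using that ab cd P(1) prime_filterD(5)[OF that(1), of a c] prime_filterD(6)[OF that(1), of b d] by auto
      ultimately show "\<exists>a\<in>P. \<exists>b\<in>carrier H - P. \<forall>Q. prime_filter H Q \<longrightarrow> a \<in> Q \<longrightarrow> b \<notin> Q \<longrightarrow> Q \<in> U \<inter> V"
        by blast
    qed
  next
    case (UN K)
    then show ?case by (meson Union_iff)
  next
    case (Basis s)
    then consider a where "a \<in> carrier H" "s = stone_map H a"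
      | b where "b \<in> carrier H" "s = {P. prime_filter H P} - stone_map H b" by auto
    then show ?case
      by cases (use P bottom_closed in \<open>auto simp: stone_map_def\<close>)
  qed auto
  then show thesis
    using that assms by blast
qed

lemma Hausdorff_dual_space: "Hausdorff_space (otop (dual_space H))"
  unfolding Hausdorff_space_def points_dual_space
proof (intro allI impI)
  fix P Q assume PQ: "P \<in> {P. prime_filter H P} \<and> Q \<in> {P. prime_filter H P} \<and> P \<noteq> Q"
  then obtain a where "a \<in> carrier H" "a \<in> P \<longleftrightarrow> a \<notin> Q"
    using prime_filterD(1) by blast
  then show "\<exists>U V. openin (otop (dual_space H)) U \<and> openin (otop (dual_space H)) V \<and> P \<in> U \<and> Q \<in> V \<and> disjnt U V"
    using openin_stone_map[of a] PQ unfolding stone_map_def disjnt_def by (cases "a \<in> P") blast+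
qed

text \<open>In a subbasic cover, \<open>X\<close> collects the elements that some set of the cover
  requires and \<open>Z\<close> those that some set forbids. A prime filter containing
  \<open>F\<close> and missing \<open>J\<close> would be uncovered, so \<open>F\<close> and
  \<open>J\<close> share an element, and its finitely many witnesses index a finite
  subcover.\<close>

lemma compact_dual_space: "compact_space (otop (dual_space H))"
proof -
  define B where "B = {stone_map H a | a. a \<in> carrier H} \<union> {{P. prime_filter H P} - stone_map H a | a. a \<in> carrier H}"
  have B: "otop (dual_space H) = topology_generated_by B"
    by (simp add: dual_space_def B_def)
  show ?thesis
  proof (rule Alexander_subbase)
    show "topology (arbitrary union_of (finite intersection_of (\<lambda>x. x \<in> B) relative_to \<Union>B)) = otop (dual_space H)"
      unfolding B by (rule topology_generated_by_subbase)
    fix \<C> assume C: "\<C> \<subseteq> B" "\<Union>\<C> = points (dual_space H)"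
    define X where "X = {a \<in> carrier H. stone_map H a \<in> \<C>}"
    define Z where "Z = {a \<in> carrier H. {P. prime_filter H P} - stone_map H a \<in> \<C>}"
    \<comment> \<open>\<open>F\<close> and \<open>J\<close> are the filter generated by \<open>Z\<close> and the ideal generated by \<open>X\<close>; bounding by all
      lower (upper) bounds avoids finite meets (joins).\<close>
    define F where "F = {z\<in>carrier H. \<exists>Z0\<subseteq>Z. finite Z0 \<and> (\<forall>u\<in>carrier H. (\<forall>b\<in>Z0. u \<sqsubseteq> b) \<longrightarrow> u \<sqsubseteq> z)}"
    define J where "J = {z\<in>carrier H. \<exists>X0\<subseteq>X. finite X0 \<and> (\<forall>u\<in>carrier H. (\<forall>a\<in>X0. a \<sqsubseteq> u) \<longrightarrow> z \<sqsubseteq> u)}"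
    have ZF: "Z \<subseteq> F" and XJ: "X \<subseteq> J"
    proof -
      show "Z \<subseteq> F"
      proof
        fix z assume "z \<in> Z"
        then show "z \<in> F"
          unfolding F_def by (auto simp: Z_def intro!: exI[of _ "{z}"])
      qed
      show "X \<subseteq> J"
      proof
        fix z assume "z \<in> X"
        then show "z \<in> J"
          unfolding J_def by (auto simp: X_def intro!: exI[of _ "{z}"])
      qed
    qed
    have "filter_in F"
      unfolding filter_in_def
    proof (intro conjI ballI impI)
      show "F \<noteq> {}"
        using top_closed unfolding F_def by (auto intro!: exI[of _ "\<top>"] exI[of _ "{}"])
      fix x y assume x: "x \<in> F"
      { assume "y \<in> carrier H" "x \<sqsubseteq> y"
        with x show "y \<in> F"
          unfolding F_def by (smt (verit) le_trans mem_Collect_eq) }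
      assume "y \<in> F"
      with x obtain S T where ST: "S \<subseteq> Z" "T \<subseteq> Z" "finite S" "finite T" "x \<in> carrier H" "y \<in> carrier H"
          "\<forall>u\<in>carrier H. (\<forall>b\<in>S. u \<sqsubseteq> b) \<longrightarrow> u \<sqsubseteq> x" "\<forall>u\<in>carrier H. (\<forall>b\<in>T. u \<sqsubseteq> b) \<longrightarrow> u \<sqsubseteq> y"
        unfolding F_def by auto
      then have "\<forall>u\<in>carrier H. (\<forall>b\<in>S \<union> T. u \<sqsubseteq> b) \<longrightarrow> u \<sqsubseteq> x \<sqinter> y"
        by (simp add: meet_le)
      then show "x \<sqinter> y \<in> F"
        unfolding F_def using ST by (intro CollectI conjI exI[of _ "S \<union> T"]) auto
    qed (auto simp: F_def)
    moreover have "ideal_in J"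
      unfolding ideal_in_def
    proof (intro conjI ballI impI)
      show "J \<noteq> {}"
        using bottom_closed unfolding J_def by (auto intro!: exI[of _ "\<bottom>"] exI[of _ "{}"])
      fix x y assume x: "x \<in> J"
      { assume "y \<in> carrier H" "y \<sqsubseteq> x"
        with x show "y \<in> J"
          unfolding J_def by (smt (verit) le_trans mem_Collect_eq) }
      assume "y \<in> J"
      with x obtain S T where ST: "S \<subseteq> X" "T \<subseteq> X" "finite S" "finite T" "x \<in> carrier H" "y \<in> carrier H"
          "\<forall>u\<in>carrier H. (\<forall>b\<in>S. b \<sqsubseteq> u) \<longrightarrow> x \<sqsubseteq> u" "\<forall>u\<in>carrier H. (\<forall>b\<in>T. b \<sqsubseteq> u) \<longrightarrow> y \<sqsubseteq> u"
        unfolding J_def by auto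
      then have "\<forall>u\<in>carrier H. (\<forall>b\<in>S \<union> T. b \<sqsubseteq> u) \<longrightarrow> x \<squnion> y \<sqsubseteq> u"
        by (simp add: join_le)
      then show "x \<squnion> y \<in> J"
        unfolding J_def using ST by (intro CollectI conjI exI[of _ "S \<union> T"]) auto
    qed (auto simp: J_def)
    moreover have "F \<inter> J \<noteq> {}"
    proof
      assume "F \<inter> J = {}"
      then obtain P where P: "prime_filter H P" "F \<subseteq> P" "P \<inter> J = {}"
        by (rule prime_filter_theorem[OF calculation])
      then obtain S where S: "S \<in> \<C>" "P \<in> S"
        using C(2) by (metis UnionE mem_Collect_eq points_dual_space)
      with C consider a where "a \<in> carrier H" "S = stone_map H a"
        | b where "b \<in> carrier H" "S = {P. prime_filter H P} - stone_map H b"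
        unfolding B_def by auto
      then show False
      proof cases
        case 1
        then have "a \<in> P \<inter> J"
          using S XJ by (auto simp: X_def stone_map_def)
        then show False using P by blast
      next
        case 2
        then have "b \<in> F"
          using S ZF by (auto simp: Z_def)
        then show False using P S 2 by (auto simp: stone_map_def)
      qed
    qed
    ultimately obtain z where z: "z \<in> F" "z \<in> J" by blast
    then obtain Z0 X0 where Z0: "Z0 \<subseteq> Z" "finite Z0" "\<And>u. u \<in> carrier H \<Longrightarrow> (\<forall>b\<in>Z0. u \<sqsubseteq> b) \<Longrightarrow> u \<sqsubseteq> z"
      and X0: "X0 \<subseteq> X" "finite X0" "\<And>u. u \<in> carrier H \<Longrightarrow> (\<forall>a\<in>X0. a \<sqsubseteq> u) \<Longrightarrow> z \<sqsubseteq> u" and zc: "z \<in> carrier H"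
      unfolding F_def J_def by auto
    have Z0c: "Z0 \<subseteq> carrier H" and X0c: "X0 \<subseteq> carrier H"
      using Z0(1) X0(1) by (auto simp: Z_def X_def)
    obtain u where u: "u \<in> carrier H" "\<And>P. prime_filter H P \<Longrightarrow> u \<in> P \<longleftrightarrow> Z0 \<subseteq> P"
      using finite_meet[OF Z0(2) Z0c] by blast
    obtain v where v: "v \<in> carrier H" "\<And>P. prime_filter H P \<Longrightarrow> v \<in> P \<longleftrightarrow> X0 \<inter> P \<noteq> {}"
      using finite_join[OF X0(2) X0c] by blast
    \<comment> \<open>The bounds defining \<open>F\<close> and \<open>J\<close> become
      \<open>u \<sqsubseteq> z \<sqsubseteq> v\<close>: a prime filter that contains all of
      \<open>Z0\<close> contains \<open>u\<close>, hence \<open>v\<close>, hence some element of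
      \<open>X0\<close>.\<close>
    have uz: "u \<sqsubseteq> z"
    proof (rule Z0(3)[OF u(1)], rule ballI, rule ccontr)
      fix b assume "b \<in> Z0" "\<not> u \<sqsubseteq> b"
      then show False
        using prime_filter_separation[of u b] u Z0c by (metis subsetD)
    qed
    have zv: "z \<sqsubseteq> v"
    proof (rule X0(3)[OF v(1)], rule ballI, rule ccontr)
      fix b assume "b \<in> X0" "\<not> b \<sqsubseteq> v"
      then show False
        using prime_filter_separation[of b v] v X0c by (metis IntI empty_iff subsetD)
    qed
    define \<C>' where "\<C>' = (stone_map H ` X0) \<union> (\<lambda>b. {P. prime_filter H P} - stone_map H b) ` Z0"
    have sub: "\<C>' \<subseteq> \<C>"
      using X0(1) Z0(1) unfolding \<C>'_def X_def Z_def by auto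
    have cov: "\<Union>\<C>' = points (dual_space H)"
    proof
      show "\<Union>\<C>' \<subseteq> points (dual_space H)" using sub C by blast
      show "points (dual_space H) \<subseteq> \<Union>\<C>'"
      proof
        fix P assume "P \<in> points (dual_space H)"
        then have P: "prime_filter H P" by (simp add: points_dual_space)
        then show "P \<in> \<Union>\<C>'"
        proof (cases "Z0 \<subseteq> P")
          case True
          then have "v \<in> P"
            using u(2)[OF P] prime_filterD(4)[OF P _ zc uz] prime_filterD(4)[OF P _ v(1) zv] by simp
          then obtain a where "a \<in> X0" "a \<in> P"
            using v(2)[OF P] by auto
          then show ?thesis
            using P unfolding \<C>'_def stone_map_def by auto
        next
          case False
          then show ?thesis
            using P unfolding \<C>'_def stone_map_def by auto
        qed
      qed
    qed
    then show "\<exists>C'. finite C' \<and> C' \<subseteq> \<C> \<and> \<Union>C' = points (dual_space H)"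
      using sub X0 Z0 by (intro exI[of _ \<C>']) (auto simp: \<C>'_def)
  qed
qed

text \<open>Compactness is used twice. For \<open>P\<close> in \<open>U\<close>, every point outside
  \<open>U\<close> omits some element of \<open>P\<close>; finitely many of these elements suffice,
  and the Stone set of their meet contains \<open>P\<close> and stays inside \<open>U\<close>.
  Finitely many such Stone sets then cover \<open>U\<close>, and a join combines them.\<close>

lemma clopen_upset_is_stone_map:
  assumes "clopen_in (dual_space H) U" "upset_of (\<subseteq>) (points (dual_space H)) U"
  obtains a where "a \<in> carrier H" "U = stone_map H a"
proof -
  let ?T = "otop (dual_space H)"
  have comp: "compactin ?T U" "compactin ?T (points (dual_space H) - U)"
    using assms(1) closedin_compact_space[OF compact_dual_space] closedin_diff[OF closedin_topspace, of ?T U]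
    unfolding clopen_in_def by auto
  have Up: "prime_filter H P" if "P \<in> U" for P
    using assms that unfolding upset_of_def points_dual_space by blast
  have "\<exists>a\<in>P. stone_map H a \<subseteq> U" if PU: "P \<in> U" for P
  proof -
    define W where "W = (\<lambda>a. {Q. prime_filter H Q \<and> a \<notin> Q}) ` P"
    have "\<Union>W \<supseteq> points (dual_space H) - U"
    proof
      fix Q assume Q: "Q \<in> points (dual_space H) - U"
      then have "\<not> P \<subseteq> Q"
        using PU assms(2) unfolding upset_of_def by blast
      then show "Q \<in> \<Union>W"
        using Q unfolding W_def points_dual_space by blast
    qed
    moreover have "openin ?T w" if "w \<in> W" for w
      using that openin_stone_map(2) prime_filterD(1)[OF Up[OF PU]] unfolding W_def by blast
    ultimately obtain F where F: "finite F" "F \<subseteq> W" "points (dual_space H) - U \<subseteq> \<Union>F"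
      using compactinD[OF comp(2), of W] by blast
    then obtain A where A: "finite A" "A \<subseteq> P" "F = (\<lambda>a. {Q. prime_filter H Q \<and> a \<notin> Q}) ` A"
      unfolding W_def by (meson finite_subset_image)
    have "A \<subseteq> carrier H"
      using A prime_filterD(1)[OF Up[OF PU]] by blast
    then obtain u where u: "u \<in> carrier H" "\<And>P. prime_filter H P \<Longrightarrow> u \<in> P \<longleftrightarrow> A \<subseteq> P"
      using finite_meet[OF A(1)] by blast
    have "u \<in> P" "stone_map H u \<subseteq> U"
    proof -
      show "u \<in> P"
        using u(2)[OF Up[OF PU]] A(2) by simp
      show "stone_map H u \<subseteq> U"
        using F(3) u(2) unfolding A(3) stone_map_def points_dual_space by auto
    qed
    then show ?thesis by blast
  qed
  then have "U \<subseteq> \<Union>{stone_map H a | a. a \<in> carrier H \<and> stone_map H a \<subseteq> U}"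
  proof (intro subsetI)
    fix P assume P: "P \<in> U"
    then obtain a where a: "a \<in> P" "stone_map H a \<subseteq> U"
      using \<open>\<And>P. P \<in> U \<Longrightarrow> \<exists>a\<in>P. stone_map H a \<subseteq> U\<close> by blast
    then have "a \<in> carrier H" "P \<in> stone_map H a"
      using prime_filterD(1)[OF Up[OF P]] Up[OF P] by (auto simp: stone_map_def)
    then show "P \<in> \<Union>{stone_map H a | a. a \<in> carrier H \<and> stone_map H a \<subseteq> U}"
      using a by auto
  qed
  moreover have "openin ?T w" if "w \<in> {stone_map H a | a. a \<in> carrier H \<and> stone_map H a \<subseteq> U}" for w
    using that openin_stone_map(1) by blast
  ultimately obtain F where F: "finite F" "F \<subseteq> {stone_map H a | a. a \<in> carrier H \<and> stone_map H a \<subseteq> U}" "U \<subseteq> \<Union>F"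
    using compactinD[OF comp(1), of "{stone_map H a | a. a \<in> carrier H \<and> stone_map H a \<subseteq> U}"] by blast
  have "F \<subseteq> stone_map H ` {a \<in> carrier H. stone_map H a \<subseteq> U}"
    using F by blast
  then obtain A where A: "finite A" "A \<subseteq> {a \<in> carrier H. stone_map H a \<subseteq> U}" "F = stone_map H ` A"
    using F(1) by (meson finite_subset_image)
  then obtain v where v: "v \<in> carrier H" "\<And>P. prime_filter H P \<Longrightarrow> v \<in> P \<longleftrightarrow> A \<inter> P \<noteq> {}"
    using finite_join[of A] by blast
  have "U = stone_map H v"
  proof (intro Set.set_eqI iffI)
    fix P assume P: "P \<in> U"
    then obtain a where "a \<in> A" "P \<in> stone_map H a"
      using F(3) A(3) by auto
    then show "P \<in> stone_map H v"
      using v(2)[of P] by (auto simp: stone_map_def)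
  next
    fix P assume "P \<in> stone_map H v"
    then obtain a where "a \<in> A" "P \<in> stone_map H a"
      using v(2)[of P] by (auto simp: stone_map_def)
    then show "P \<in> U"
      using A(2) by auto
  qed
  then show thesis
    using that v by blast
qed

text \<open>By compactness \<open>V\<close> is a finite union of sets given by containing some
  \<open>a\<close> and omitting some \<open>b\<close>. The downset of such a set consists of the
  prime filters that omit \<open>a \<Rrightarrow> b\<close>, which is clopen.\<close>

lemma clopen_downset:
  assumes "clopen_in (dual_space H) V"
  shows "clopen_in (dual_space H) {P. prime_filter H P \<and> (\<exists>Q\<in>V. P \<subseteq> Q)}"
proof -
  let ?T = "otop (dual_space H)"
  let ?V = "\<lambda>(a,b). {P. prime_filter H P \<and> a \<in> P \<and> b \<notin> P}"
  have VP: "V \<subseteq> {P. prime_filter H P}"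
    using assms closedin_subset unfolding clopen_in_def points_dual_space[symmetric] by blast
  have comp: "compactin ?T V"
    using assms compact_dual_space closedin_compact_space unfolding clopen_in_def by auto
  define W where "W = {(a,b). a \<in> carrier H \<and> b \<in> carrier H \<and> ?V (a,b) \<subseteq> V}"
  have op: "openin ?T w" if "w \<in> ?V ` W" for w
  proof -
    from that obtain a b where ab: "a \<in> carrier H" "b \<in> carrier H" "w = ?V (a,b)"
      unfolding W_def by auto
    have "w = stone_map H a \<inter> {P. prime_filter H P \<and> b \<notin> P}"
      unfolding ab by (auto simp: stone_map_def)
    then show ?thesis
      using openin_stone_map ab by auto
  qed
  have "V \<subseteq> \<Union>(?V ` W)"
  proof
    fix P assume P: "P \<in> V"
    then have PP: "prime_filter H P" using VP by blast
    obtain a b where "a \<in> P" "b \<in> carrier H - P" "\<And>Q. prime_filter H Q \<Longrightarrow> a \<in> Q \<Longrightarrow> b \<notin> Q \<Longrightarrow> Q \<in> V"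
      using dual_space_base[of V P] assms P unfolding clopen_in_def by blast
    then have "(a,b) \<in> W" "P \<in> ?V (a,b)"
      using prime_filterD(1)[OF PP] PP unfolding W_def by auto
    then show "P \<in> \<Union>(?V ` W)" by blast
  qed
  then obtain F where F: "finite F" "F \<subseteq> ?V ` W" "V \<subseteq> \<Union>F"
    using compactinD[OF comp, of "?V ` W"] op by blast
  then obtain A where A: "finite A" "A \<subseteq> W" "F = ?V ` A"
    by (meson finite_subset_image)
  have V: "V = \<Union>(?V ` A)"
    using A F unfolding W_def by blast
  have "{P. prime_filter H P \<and> (\<exists>Q\<in>V. P \<subseteq> Q)} = (\<Union>(a,b)\<in>A. {P. prime_filter H P \<and> (a \<Rrightarrow> b) \<notin> P})"
    (is "?L = ?R")
  proof (intro Set.set_eqI iffI)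
    fix P assume "P \<in> ?L"
    then obtain Q a b where "prime_filter H P" "P \<subseteq> Q" "(a,b) \<in> A" "prime_filter H Q" "a \<in> Q" "b \<notin> Q"
      unfolding V by auto
    moreover from this have "a \<in> carrier H" "b \<in> carrier H"
      using A W_def by auto
    ultimately have "(a \<Rrightarrow> b) \<notin> P"
      using imp_in_prime_filter by blast
    then show "P \<in> ?R"
      using \<open>(a,b) \<in> A\<close> \<open>prime_filter H P\<close> by auto
  next
    fix P assume "P \<in> ?R"
    then obtain a b where ab: "prime_filter H P" "(a,b) \<in> A" "(a \<Rrightarrow> b) \<notin> P" by auto
    moreover from this have "a \<in> carrier H" "b \<in> carrier H"
      using A W_def by auto
    ultimately obtain Q where "prime_filter H Q" "P \<subseteq> Q" "a \<in> Q" "b \<notin> Q"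
      using imp_notin_prime_filter by blast
    then show "P \<in> ?L"
      unfolding V using ab by auto
  qed
  moreover have "clopen_in (dual_space H) {P. prime_filter H P \<and> (a \<Rrightarrow> b) \<notin> P}" if "(a,b) \<in> A" for a b
  proof -
    have c: "(a \<Rrightarrow> b) \<in> carrier H"
      using that A imp_closed by (auto simp: W_def)
    show ?thesis
      using clopen_stone_map[OF c] openin_stone_map[OF c]
      by (simp add: clopen_in_def closedin_def points_dual_space flip: stone_map_compl)
         (metis double_diff order_refl)
  qed
  ultimately show ?thesis
    using A(1) unfolding clopen_in_def
    by (auto intro!: closedin_Union openin_Union)
qed

end

section \<open>Homomorphisms\<close>

lemma heyting_homD:
  assumes "h \<in> heyting_hom G H"
  shows "\<And>x. x \<in> carrier G \<Longrightarrow> h x \<in> carrier H" "h \<bottom>\<^bsub>G\<^esub> = \<bottom>\<^bsub>H\<^esub>" "h \<top>\<^bsub>G\<^esub> = \<top>\<^bsub>H\<^esub>"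
    "\<And>x y. x \<in> carrier G \<Longrightarrow> y \<in> carrier G \<Longrightarrow> h (x \<sqinter>\<^bsub>G\<^esub> y) = h x \<sqinter>\<^bsub>H\<^esub> h y"
    "\<And>x y. x \<in> carrier G \<Longrightarrow> y \<in> carrier G \<Longrightarrow> h (x \<squnion>\<^bsub>G\<^esub> y) = h x \<squnion>\<^bsub>H\<^esub> h y"
    "\<And>x y. x \<in> carrier G \<Longrightarrow> y \<in> carrier G \<Longrightarrow> h (x \<Rrightarrow>\<^bsub>G\<^esub> y) = h x \<Rrightarrow>\<^bsub>H\<^esub> h y"
  using assms unfolding heyting_hom_def by auto

definition filter_preimage :: "'a heyting \<Rightarrow> ('a \<Rightarrow> 'b) \<Rightarrow> 'b set \<Rightarrow> 'a set" where
  "filter_preimage G h P = {x \<in> carrier G. h x \<in> P}"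

lemma heyting_hom_mono:
  assumes "heyting_algebra G" "heyting_algebra H" "h \<in> heyting_hom G H"
    and xy: "x \<in> carrier G" "y \<in> carrier G" "x \<sqsubseteq>\<^bsub>G\<^esub> y"
  shows "h x \<sqsubseteq>\<^bsub>H\<^esub> h y"
proof -
  interpret G: heyting_algebra G by fact
  interpret H: heyting_algebra H by fact
  note h = heyting_homD[OF assms(3)]
  have "x \<sqinter>\<^bsub>G\<^esub> y = x"
    using G.le_iff_join[OF xy(1,2)] xy(3) by simp
  then have "h x = h x \<sqinter>\<^bsub>H\<^esub> h y"
    using h(4)[OF xy(1,2)] by simp
  then show ?thesis
    using H.meet_right[of "h x" "h y"] h(1) xy by simp
qed

lemma prime_filter_preimage:
  assumes "heyting_algebra G" "heyting_algebra H" "h \<in> heyting_hom G H" "prime_filter H P"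
  shows "prime_filter G (filter_preimage G h P)"
proof -
  interpret G: heyting_algebra G by fact
  interpret H: heyting_algebra H by fact
  note h = heyting_homD[OF assms(3)]
  note P = H.prime_filterD[OF assms(4)]
  show ?thesis
    unfolding prime_filter_def
  proof (intro conjI ballI impI)
    show "filter_preimage G h P \<noteq> {}" "filter_preimage G h P \<noteq> carrier G"
    proof -
      have "\<top>\<^bsub>G\<^esub> \<in> filter_preimage G h P" "\<bottom>\<^bsub>G\<^esub> \<notin> filter_preimage G h P"
        using h(2,3) P(2,3) by (auto simp: filter_preimage_def)
      then show "filter_preimage G h P \<noteq> {}" "filter_preimage G h P \<noteq> carrier G"
        using G.bottom_closed by blast+
    qed
  next
    fix x y assume "x \<in> filter_preimage G h P" "y \<in> carrier G" "x \<sqsubseteq>\<^bsub>G\<^esub> y"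
    then show "y \<in> filter_preimage G h P"
      using heyting_hom_mono[OF assms(1-3)] P(4) h(1) unfolding filter_preimage_def by blast
  qed (use h P in \<open>auto simp: filter_preimage_def\<close>)
qed

text \<open>This is the back condition that makes dual maps p-morphisms. The filter generated by
  \<open>P\<close> and the image of \<open>Q\<close> misses the ideal generated by the image of the
  complement of \<open>Q\<close>: from \<open>p \<sqinter> h q \<sqsubseteq> h b\<close> one gets
  \<open>p \<sqsubseteq> h (q \<Rrightarrow> b)\<close>, so \<open>q \<Rrightarrow> b\<close> is in
  \<open>Q\<close>, and then so is \<open>b\<close>.\<close>

lemma prime_filter_lifting:
  assumes "heyting_algebra G" "heyting_algebra H" "h \<in> heyting_hom G H" "prime_filter H P"
    and Q: "prime_filter G Q" "filter_preimage G h P \<subseteq> Q"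
  obtains R where "prime_filter H R" "P \<subseteq> R" "filter_preimage G h R = Q"
proof -
  interpret G: heyting_algebra G by fact
  interpret H: heyting_algebra H by fact
  note h = heyting_homD[OF assms(3)]
  note P = H.prime_filterD[OF assms(4)]
  note Q' = G.prime_filterD[OF Q(1)]
  \<comment> \<open>The image of the complement of \<open>Q\<close> need not be downward closed,
    hence the closure under \<open>\<sqsubseteq>\<close>; joins stay inside because \<open>Q\<close>
    is prime.\<close>
  define J where "J = {z \<in> carrier H. \<exists>b\<in>carrier G - Q. z \<sqsubseteq>\<^bsub>H\<^esub> h b}"
  define F where "F = {z \<in> carrier H. \<exists>p\<in>P. \<exists>q\<in>h ` Q. p \<sqinter>\<^bsub>H\<^esub> q \<sqsubseteq>\<^bsub>H\<^esub> z}"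
  have hQ: "x \<sqinter>\<^bsub>H\<^esub> y \<in> h ` Q" if "x \<in> h ` Q" "y \<in> h ` Q" for x y
  proof -
    obtain q r where "q \<in> Q" "r \<in> Q" "x = h q" "y = h r"
      using \<open>x \<in> h ` Q\<close> \<open>y \<in> h ` Q\<close> by auto
    then show ?thesis
      using h(4)[of q r] Q'(1) Q'(5)[of q r] by (metis image_eqI subsetD)
  qed
  have F: "H.filter_in F" "P \<subseteq> F" "h ` Q \<subseteq> F"
  proof -
    have "h ` Q \<subseteq> carrier H" "h ` Q \<noteq> {}"
      using h(1) Q'(1,2) by auto
    then show "H.filter_in F" "P \<subseteq> F" "h ` Q \<subseteq> F"
      unfolding F_def using H.filter_adjoin[OF P(7) _ _ hQ] by auto
  qed
  have J: "H.ideal_in J"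
    unfolding H.ideal_in_def
  proof (intro conjI ballI impI)
    show "J \<subseteq> carrier H" "J \<noteq> {}"
      unfolding J_def using Q'(3) G.bottom_closed h(1)[of "\<bottom>\<^bsub>G\<^esub>"] H.le_refl by blast+
    fix x y assume x: "x \<in> J"
    { assume "y \<in> carrier H" "y \<sqsubseteq>\<^bsub>H\<^esub> x"
      moreover obtain b where "b \<in> carrier G - Q" "x \<sqsubseteq>\<^bsub>H\<^esub> h b" "x \<in> carrier H"
        using x unfolding J_def by auto
      ultimately show "y \<in> J"
        unfolding J_def using h(1)[of b] H.le_trans[of y x "h b"] by auto }
    assume "y \<in> J"
    with x obtain b c where bc: "b \<in> carrier G - Q" "c \<in> carrier G - Q" "x \<sqsubseteq>\<^bsub>H\<^esub> h b" "y \<sqsubseteq>\<^bsub>H\<^esub> h c"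
      "x \<in> carrier H" "y \<in> carrier H"
      unfolding J_def by auto
    then have "x \<squnion>\<^bsub>H\<^esub> y \<sqsubseteq>\<^bsub>H\<^esub> h (b \<squnion>\<^bsub>G\<^esub> c)"
      using h H.join_mono by auto
    moreover have "b \<squnion>\<^bsub>G\<^esub> c \<in> carrier G - Q"
      using bc(1,2) Q'(6)[of b c] by auto
    ultimately show "x \<squnion>\<^bsub>H\<^esub> y \<in> J"
      unfolding J_def using bc(5,6) by auto
  qed
  have "F \<inter> J = {}"
  proof (rule ccontr)
    assume "\<not> ?thesis"
    then obtain z p q b where z: "z \<in> carrier H" "p \<in> P" "q \<in> Q" "p \<sqinter>\<^bsub>H\<^esub> h q \<sqsubseteq>\<^bsub>H\<^esub> z"
      "b \<in> carrier G - Q" "z \<sqsubseteq>\<^bsub>H\<^esub> h b"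
      unfolding F_def J_def by blast
    have c: "p \<in> carrier H" "q \<in> carrier G" "b \<in> carrier G" "h q \<in> carrier H" "h b \<in> carrier H"
      using z P(1) Q'(1) h(1) by auto
    have "p \<sqinter>\<^bsub>H\<^esub> h q \<sqsubseteq>\<^bsub>H\<^esub> h b"
      using H.le_trans[OF z(4,6)] z(1) c by simp
    then have "p \<sqsubseteq>\<^bsub>H\<^esub> h (q \<Rrightarrow>\<^bsub>G\<^esub> b)"
      using H.residuation[of "h q" "h b" p] c h(6)[of q b] by auto
    then have "(q \<Rrightarrow>\<^bsub>G\<^esub> b) \<in> filter_preimage G h P"
      using P(4)[OF z(2)] c h(1) G.imp_closed unfolding filter_preimage_def by auto
    then have "(q \<Rrightarrow>\<^bsub>G\<^esub> b) \<in> Q"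
      using Q(2) by blast
    then show False
      using G.imp_in_prime_filter[OF Q(1)] Q(1) c z by blast
  qed
  then obtain R where R: "prime_filter H R" "F \<subseteq> R" "R \<inter> J = {}"
    using H.prime_filter_theorem[OF F(1) J] by blast
  have "filter_preimage G h R = Q"
  proof
    show "filter_preimage G h R \<subseteq> Q"
    proof
      fix x assume "x \<in> filter_preimage G h R"
      then have x: "x \<in> carrier G" "h x \<in> R" by (auto simp: filter_preimage_def)
      then have "h x \<in> J" if "x \<notin> Q"
        using that h(1) H.le_refl unfolding J_def by blast
      then show "x \<in> Q"
        using R(3) x by blast
    qed
    show "Q \<subseteq> filter_preimage G h R"
      using F(3) R(2) Q'(1) unfolding filter_preimage_def by blast
  qed
  then show thesis
    using that R F by blast
qed

section \<open>Bounded depth\<close>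

definition up_prime :: "'a heyting \<Rightarrow> 'a set \<Rightarrow> 'a set set" where
  "up_prime H P = {Q. prime_filter H Q \<and> P \<subseteq> Q}"

lemma bd_closed:
  assumes "heyting_algebra H" "x \<in> {1..n} \<rightarrow> carrier H"
  shows "bd H x n \<in> carrier H"
proof -
  interpret heyting_algebra H by fact
  show ?thesis
    using assms(2) by (induction n) (auto intro!: join_closed imp_closed simp: Pi_def)
qed

text \<open>Prelinearity and primality put \<open>a \<Rrightarrow> b\<close> or
  \<open>b \<Rrightarrow> a\<close> into \<open>P\<close>, which excludes having \<open>a\<close>
  only in \<open>Q\<close> and \<open>b\<close> only in \<open>R\<close>.\<close>

lemma goedel_up_prime_chain:
  fixes H (structure)
  assumes "goedel_algebra H" "prime_filter H P" "Q \<in> up_prime H P" "R \<in> up_prime H P"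
  shows "Q \<subseteq> R \<or> R \<subseteq> Q"
proof (rule ccontr)
  interpret goedel_algebra H by fact
  have QR: "prime_filter H Q" "P \<subseteq> Q" "prime_filter H R" "P \<subseteq> R"
    using assms by (auto simp: up_prime_def)
  assume "\<not> ?thesis"
  then obtain a b where ab: "a \<in> Q" "a \<notin> R" "b \<in> R" "b \<notin> Q" by blast
  have c: "a \<in> carrier H" "b \<in> carrier H"
    using ab prime_filterD(1)[OF QR(1)] prime_filterD(1)[OF QR(3)] by auto
  have "(a \<Rrightarrow> b) \<squnion> (b \<Rrightarrow> a) \<in> P"
    using prelinear[OF c] prime_filterD(2)[OF assms(2)] by simp
  then have "(a \<Rrightarrow> b) \<in> P \<or> (b \<Rrightarrow> a) \<in> P"
    using prime_filterD(6)[OF assms(2)] c imp_closed by auto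
  then show False
    using imp_in_prime_filter[OF assms(2)] c ab QR by auto
qed

text \<open>A refuting valuation is read off a chain of prime filters above \<open>P\<close>. The
  variable of highest index gets an element \<open>a\<close> of a larger filter \<open>Q\<close>
  that is not in \<open>P\<close>. Its implication into the lower level of \<open>bd\<close> is not
  in \<open>P\<close> either, as \<open>Q\<close> contains \<open>a\<close> but not that lower
  level.\<close>

lemma bd_notin_prime_filter:
  fixes H (structure)
  assumes H: "goedel_algebra H" and P: "prime_filter H P"
    and "\<not> (finite (up_prime H P) \<and> card (up_prime H P) \<le> n)"
  obtains x where "x \<in> {1..n} \<rightarrow> carrier H" "bd H x n \<notin> P"
proof -
  interpret goedel_algebra H by fact
  have "\<exists>x \<in> {1..n} \<rightarrow> carrier H. bd H x n \<notin> P"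
    using P assms(3)
  proof (induction n arbitrary: P)
    case 0
    then show ?case
      using prime_filterD(3) by auto
  next
    case (Suc n)
    have "\<not> (finite (up_prime H P - {P}) \<and> card (up_prime H P - {P}) \<le> n)"
      using Suc.prems by (auto simp: up_prime_def card_Diff_singleton)
    \<comment> \<open>Discarding \<open>P\<close> itself lowers the bound by exactly one. Keeping
      just \<open>Suc n\<close> filters covers the infinite case as well and guarantees a minimal
      one.\<close>
    then obtain F where F: "finite F" "F \<subseteq> up_prime H P - {P}" "card F = Suc n"
      by (metis infinite_arbitrarily_large not_less_eq_eq obtain_subset_with_card_n)
    then have "F \<noteq> {}"
      by auto
    then obtain Q where Q: "Q \<in> F" "\<And>R. R \<in> F \<Longrightarrow> R \<subseteq> Q \<Longrightarrow> R = Q"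
      using finite_has_minimal[OF F(1)] by metis
    have QP: "prime_filter H Q" "P \<subset> Q"
      using Q F by (auto simp: up_prime_def)
    have "F \<subseteq> up_prime H Q"
    proof
      fix R assume R: "R \<in> F"
      then have "Q \<subseteq> R \<or> R \<subseteq> Q"
        using goedel_up_prime_chain[OF H Suc.prems(1), of Q R] Q(1) F(2) by blast
      then show "R \<in> up_prime H Q"
        using R Q(2) F(2) by (auto simp: up_prime_def)
    qed
    then have "\<not> (finite (up_prime H Q) \<and> card (up_prime H Q) \<le> n)"
      using F(3) by (metis card_mono not_less_eq_eq order_trans)
    then obtain x where x: "x \<in> {1..n} \<rightarrow> carrier H" "bd H x n \<notin> Q"
      using Suc.IH[OF QP(1)] by blast
    obtain a where a: "a \<in> Q" "a \<notin> P" "a \<in> carrier H"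
      using QP prime_filterD(1)[OF QP(1)] by blast
    define y where "y = x(Suc n := a)"
    have y: "y \<in> {1..Suc n} \<rightarrow> carrier H"
      using x a by (auto simp: y_def Pi_def)
    \<comment> \<open>The levels up to \<open>n\<close> never read the variable of index
      \<open>Suc n\<close>.\<close>
    have "bd H y k = bd H x k" if "k \<le> n" for k
      using that by (induction k) (auto simp: y_def)
    then have bd: "bd H y (Suc n) = a \<squnion> (a \<Rrightarrow> bd H x n)"
      by (simp add: y_def)
    have c: "bd H x n \<in> carrier H"
      using bd_closed x heyting_algebra_axioms by blast
    have "(a \<Rrightarrow> bd H x n) \<notin> P"
      using imp_in_prime_filter[OF Suc.prems(1) a(3) c] QP a(1) x(2) by blast
    then have "bd H y (Suc n) \<notin> P"
      unfolding bd using prime_filterD(6)[OF Suc.prems(1)] a c imp_closed by auto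
    then show ?case
      using y by blast
  qed
  then show thesis
    using that by blast
qed

lemma GA_up_prime_finite:
  assumes "H \<in> GA n" "prime_filter H P"
  shows "finite (up_prime H P)" "card (up_prime H P) \<le> n"
proof -
  have H: "goedel_algebra H" "\<forall>x\<in>{1..n} \<rightarrow> carrier H. bd H x n = \<top>\<^bsub>H\<^esub>"
    using assms by (auto simp: GA_def)
  interpret goedel_algebra H by fact
  have "finite (up_prime H P) \<and> card (up_prime H P) \<le> n"
    using bd_notin_prime_filter[OF H(1) assms(2), of n] H(2) prime_filterD(2)[OF assms(2)] by metis
  then show "finite (up_prime H P)" "card (up_prime H P) \<le> n" by auto
qed

section \<open>Dual algebras\<close>

text \<open>These conditions make the clopen upsets a Heyting algebra: \<open>clopen_down\<close>
  and transitivity turn implications into clopen upsets, and reflexivity gives one half of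
  residuation. Compactness is added only where prime filters have to be represented by
  points.\<close>

locale esakia_order =
  fixes Y :: "'x ordered_space"
  assumes ole_refl: "x \<in> points Y \<Longrightarrow> ole Y x x"
    and ole_trans: "\<lbrakk>ole Y x y; ole Y y z; x \<in> points Y; y \<in> points Y; z \<in> points Y\<rbrakk> \<Longrightarrow> ole Y x z"
    and clopen_down: "clopen_in Y V \<Longrightarrow> clopen_in Y {x \<in> points Y. \<exists>y\<in>V. ole Y x y}"
begin

abbreviation "K \<equiv> dual_algebra Y"

lemma carrier_dual_algebra:
  "U \<in> carrier K \<longleftrightarrow> clopen_in Y U \<and> upset_of (ole Y) (points Y) U"
  by (simp add: dual_algebra_def)

lemma le_dual_algebra [simp]: "U \<sqsubseteq>\<^bsub>K\<^esub> V \<longleftrightarrow> U \<subseteq> V"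
  by (simp add: dual_algebra_def)

lemma eq_dual_algebra [simp]: "U .=\<^bsub>K\<^esub> V \<longleftrightarrow> U = V"
  by (simp add: dual_algebra_def)

lemma carrier_subset: "U \<in> carrier K \<Longrightarrow> U \<subseteq> points Y"
  by (simp add: carrier_dual_algebra upset_of_def)

lemma dual_algebra_closed:
  shows "{} \<in> carrier K" "points Y \<in> carrier K"
    "\<And>U V. U \<in> carrier K \<Longrightarrow> V \<in> carrier K \<Longrightarrow> U \<union> V \<in> carrier K"
    "\<And>U V. U \<in> carrier K \<Longrightarrow> V \<in> carrier K \<Longrightarrow> U \<inter> V \<in> carrier K"
  unfolding carrier_dual_algebra clopen_in_def upset_of_def by auto

lemma dual_algebra_imp:
  "U \<Rrightarrow>\<^bsub>K\<^esub> V = {x \<in> points Y. \<forall>y\<in>U - V. \<not> ole Y x y}"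
  by (auto simp: dual_algebra_def)

lemma dual_algebra_imp_closed:
  assumes "U \<in> carrier K" "V \<in> carrier K"
  shows "U \<Rrightarrow>\<^bsub>K\<^esub> V \<in> carrier K"
proof -
  have "clopen_in Y (U - V)"
    using assms by (auto simp: carrier_dual_algebra clopen_in_def)
  from clopen_down[OF this] have "clopen_in Y (points Y - {x \<in> points Y. \<exists>y\<in>U - V. ole Y x y})"
    by (auto simp: clopen_in_def)
  moreover have "upset_of (ole Y) (points Y) (points Y - {x \<in> points Y. \<exists>y\<in>U - V. ole Y x y})"
    unfolding upset_of_def
  proof (intro conjI ballI impI)
    fix x y assume x: "x \<in> points Y - {x \<in> points Y. \<exists>y\<in>U - V. ole Y x y}" and y: "y \<in> points Y" "ole Y x y"
    have "\<not> ole Y y z" if "z \<in> U - V" for z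
      using ole_trans[of x y z] that x y carrier_subset[OF assms(1)] by auto
    then show "y \<in> points Y - {x \<in> points Y. \<exists>y\<in>U - V. ole Y x y}"
      using y by simp
  qed auto
  ultimately show ?thesis
    by (simp add: dual_algebra_def)
qed

sublocale partial_order K
  by unfold_locales (auto simp: dual_algebra_def)

sublocale bounded_lattice K
proof unfold_locales
  show "\<exists>s. is_lub K s {U, V}" if "U \<in> carrier K" "V \<in> carrier K" for U V
    using that dual_algebra_closed(3)[OF that] by (intro exI[of _ "U \<union> V"]) (simp add: least_def Upper_def)
  show "\<exists>s. is_glb K s {U, V}" if "U \<in> carrier K" "V \<in> carrier K" for U V
    using that dual_algebra_closed(4)[OF that] by (intro exI[of _ "U \<inter> V"]) (simp add: greatest_def Lower_def)
  show "\<exists>x. least K x (carrier K)"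
    using dual_algebra_closed(1) by (intro exI[of _ "{}"]) (auto simp: least_def)
  show "\<exists>x. greatest K x (carrier K)"
    using dual_algebra_closed(2) carrier_subset by (intro exI[of _ "points Y"]) (auto simp: greatest_def)
qed

lemma dual_algebra_ops:
  shows "\<bottom>\<^bsub>K\<^esub> = {}" "\<top>\<^bsub>K\<^esub> = points Y"
    "\<And>U V. U \<in> carrier K \<Longrightarrow> V \<in> carrier K \<Longrightarrow> U \<squnion>\<^bsub>K\<^esub> V = U \<union> V"
    "\<And>U V. U \<in> carrier K \<Longrightarrow> V \<in> carrier K \<Longrightarrow> U \<sqinter>\<^bsub>K\<^esub> V = U \<inter> V"
proof -
  show "\<bottom>\<^bsub>K\<^esub> = {}"
    using bottom_eq[OF dual_algebra_closed(1)] by auto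
  show "\<top>\<^bsub>K\<^esub> = points Y"
    using top_eq[OF dual_algebra_closed(2)] carrier_subset by auto
  fix U V assume UV: "U \<in> carrier K" "V \<in> carrier K"
  show "U \<squnion>\<^bsub>K\<^esub> V = U \<union> V"
  proof
    show "U \<union> V \<subseteq> U \<squnion>\<^bsub>K\<^esub> V"
      using join_left[OF UV] join_right[OF UV] by auto
    show "U \<squnion>\<^bsub>K\<^esub> V \<subseteq> U \<union> V"
      using join_le[of U "U \<union> V" V] UV dual_algebra_closed(3)[OF UV] by auto
  qed
  show "U \<sqinter>\<^bsub>K\<^esub> V = U \<inter> V"
  proof
    show "U \<sqinter>\<^bsub>K\<^esub> V \<subseteq> U \<inter> V"
      using meet_left[OF UV] meet_right[OF UV] by auto
    show "U \<inter> V \<subseteq> U \<sqinter>\<^bsub>K\<^esub> V"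
      using meet_le[of "U \<inter> V" U V] UV dual_algebra_closed(4)[OF UV] by auto
  qed
qed

sublocale heyting_algebra K
proof unfold_locales
  fix U V W assume UV: "U \<in> carrier K" "V \<in> carrier K"
  show "U \<Rrightarrow>\<^bsub>K\<^esub> V \<in> carrier K"
    using UV by (rule dual_algebra_imp_closed)
  assume W: "W \<in> carrier K"
  have "W \<subseteq> U \<Rrightarrow>\<^bsub>K\<^esub> V \<longleftrightarrow> W \<inter> U \<subseteq> V"
  proof
    assume *: "W \<subseteq> U \<Rrightarrow>\<^bsub>K\<^esub> V"
    show "W \<inter> U \<subseteq> V"
    proof
      fix x assume "x \<in> W \<inter> U"
      then show "x \<in> V"
        using * ole_refl[of x] by (auto simp: dual_algebra_imp)
    qed
  next
    assume *: "W \<inter> U \<subseteq> V"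
    show "W \<subseteq> U \<Rrightarrow>\<^bsub>K\<^esub> V"
      unfolding dual_algebra_imp
      using * W carrier_subset[OF UV(1)] carrier_subset[OF W]
      by (fastforce simp: carrier_dual_algebra upset_of_def)
  qed
  then show "W \<sqsubseteq>\<^bsub>K\<^esub> U \<Rrightarrow>\<^bsub>K\<^esub> V \<longleftrightarrow> W \<sqinter>\<^bsub>K\<^esub> U \<sqsubseteq>\<^bsub>K\<^esub> V"
    using UV W by (simp add: dual_algebra_ops)
qed

text \<open>If prelinearity failed at \<open>x\<close>, some \<open>y\<close> in
  \<open>U - V\<close> and some \<open>z\<close> in \<open>V - U\<close> would lie above
  \<open>x\<close>; as they are comparable, upward closure would drag one of them into the other
  set.\<close>

lemma goedel_dual_algebra:
  assumes "\<And>x y z. \<lbrakk>x \<in> points Y; y \<in> points Y; z \<in> points Y; ole Y x y; ole Y x z\<rbrakk> \<Longrightarrow> ole Y y z \<or> ole Y z y"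
  shows "goedel_algebra K"
proof unfold_locales
  fix U V assume UV: "U \<in> carrier K" "V \<in> carrier K"
  have "x \<in> (U \<Rrightarrow>\<^bsub>K\<^esub> V) \<union> (V \<Rrightarrow>\<^bsub>K\<^esub> U)" if x: "x \<in> points Y" for x
  proof (rule ccontr)
    assume "\<not> ?thesis"
    then obtain y z where "y \<in> U" "y \<notin> V" "z \<in> V" "z \<notin> U" "ole Y x y" "ole Y x z"
      using x by (auto simp: dual_algebra_imp)
    moreover from this have "y \<in> points Y" "z \<in> points Y"
      using UV carrier_subset by auto
    ultimately show False
      using assms[of x y z] x UV by (auto simp: carrier_dual_algebra upset_of_def)
  qed
  then have "(U \<Rrightarrow>\<^bsub>K\<^esub> V) \<union> (V \<Rrightarrow>\<^bsub>K\<^esub> U) = points Y"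
    by (auto simp: dual_algebra_imp)
  then show "(U \<Rrightarrow>\<^bsub>K\<^esub> V) \<squnion>\<^bsub>K\<^esub> (V \<Rrightarrow>\<^bsub>K\<^esub> U) = \<top>\<^bsub>K\<^esub>"
    using UV by (simp add: dual_algebra_ops dual_algebra_imp_closed)
qed

text \<open>A point represents \<open>P\<close> iff it avoids the complements of the members of
  \<open>P\<close> and all clopen upsets outside \<open>P\<close>. If these open sets covered the
  space, finitely many would, and a finite intersection of members of \<open>P\<close> would lie
  inside a finite union of nonmembers, against primality.\<close>

lemma prime_filter_dual_algebra:
  assumes "compact_space (otop Y)" "prime_filter K P"
  obtains x where "x \<in> points Y" "P = {U \<in> carrier K. x \<in> U}"
proof -
  note P = prime_filterD[OF assms(2)]
  define \<C> where "\<C> = (\<lambda>U. points Y - U) ` P \<union> (carrier K - P)"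
  have op: "openin (otop Y) W" if "W \<in> \<C>" for W
    using that subsetD[OF P(1)] by (auto simp: \<C>_def carrier_dual_algebra clopen_in_def)
  have "\<not> points Y \<subseteq> \<Union>\<C>"
  proof
    assume "points Y \<subseteq> \<Union>\<C>"
    then obtain F where F: "finite F" "F \<subseteq> \<C>" "points Y \<subseteq> \<Union>F"
      using compactinD[OF assms(1)[unfolded compact_space_def], of \<C>] op by metis
    \<comment> \<open>The complements of members of \<open>P\<close> are split off first; whatever
      remains in \<open>F\<close> is then a clopen upset outside \<open>P\<close>.\<close>
    obtain A where A: "A \<subseteq> P" "finite A" "F \<inter> (\<lambda>U. points Y - U) ` P = (\<lambda>U. points Y - U) ` A"
      using finite_subset_image[of "F \<inter> (\<lambda>U. points Y - U) ` P" "\<lambda>U. points Y - U" P] F(1) by auto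
    have join: "\<Union>G \<in> carrier K - P" if "finite G" "G \<subseteq> carrier K - P" for G
      using that
    proof (induction G)
      case empty
      then show ?case
        using P(3) dual_algebra_closed(1) by (simp add: dual_algebra_ops)
    next
      case (insert U G)
      then have U: "U \<in> carrier K" "\<Union>G \<in> carrier K" "U \<notin> P" "\<Union>G \<notin> P" by auto
      then have "U \<squnion>\<^bsub>K\<^esub> \<Union>G \<notin> P" "U \<squnion>\<^bsub>K\<^esub> \<Union>G \<in> carrier K"
        using P(6)[OF U(1,2)] by auto
      then show ?case
        by (simp add: dual_algebra_ops U)
    qed
    \<comment> \<open>Intersecting with \<open>points Y\<close> makes the empty intersection the top
      element.\<close>
    have "\<Inter>A \<inter> points Y \<in> P"
      using A(2,1)
    proof (induction A)
      case empty
      then show ?case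
        using P(2) by (simp add: dual_algebra_ops)
    next
      case (insert U A)
      then have U: "U \<in> carrier K" "\<Inter>A \<inter> points Y \<in> carrier K"
        using P(1) by auto
      then have "U \<sqinter>\<^bsub>K\<^esub> (\<Inter>A \<inter> points Y) \<in> P"
        using insert P(5)[OF U] by simp
      then show ?case
        by (simp add: dual_algebra_ops U Int_assoc)
    qed
    moreover have "\<Union>(F - (\<lambda>U. points Y - U) ` P) \<in> carrier K - P"
    proof (rule join)
      show "finite (F - (\<lambda>U. points Y - U) ` P)" "F - (\<lambda>U. points Y - U) ` P \<subseteq> carrier K - P"
        using F by (auto simp: \<C>_def)
    qed
    moreover have "\<Inter>A \<inter> points Y \<subseteq> \<Union>(F - (\<lambda>U. points Y - U) ` P)"
    proof
      fix x assume x: "x \<in> \<Inter>A \<inter> points Y"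
      then obtain W where W: "W \<in> F" "x \<in> W"
        using F(3) by auto
      have "W \<notin> (\<lambda>U. points Y - U) ` A"
        using x W(2) by auto
      then have "W \<notin> (\<lambda>U. points Y - U) ` P"
        using A(3) W(1) by auto
      then show "x \<in> \<Union>(F - (\<lambda>U. points Y - U) ` P)"
        using W by auto
    qed
    ultimately show False
      using P(4)[of "\<Inter>A \<inter> points Y" "\<Union>(F - (\<lambda>U. points Y - U) ` P)"] by simp
  qed
  then obtain x where x: "x \<in> points Y" "x \<notin> \<Union>\<C>" by blast
  have "P = {U \<in> carrier K. x \<in> U}"
  proof (intro subset_antisym subsetI)
    fix U assume "U \<in> P"
    moreover from this have "points Y - U \<in> \<C>"
      by (simp add: \<C>_def)
    ultimately show "U \<in> {U \<in> carrier K. x \<in> U}"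
      using x P(1) by auto
  next
    fix U assume "U \<in> {U \<in> carrier K. x \<in> U}"
    then show "U \<in> P"
      using x(2) by (auto simp: \<C>_def)
  qed
  then show thesis
    by (rule that[OF x(1)])
qed

end

section \<open>The space of closed chains\<close>

lemma closedin_Collect_ball:
  assumes "\<And>q. q \<in> Q \<Longrightarrow> closedin T {x \<in> topspace T. p q x}"
  shows "closedin T {x \<in> topspace T. \<forall>q\<in>Q. p q x}"
proof (cases "Q = {}")
  case False
  have "{x \<in> topspace T. \<forall>q\<in>Q. p q x} = (\<Inter>q\<in>Q. {x \<in> topspace T. p q x})"
    using False by auto
  then show ?thesis
    using False assms by (auto intro!: closedin_INT)
qed simp

lemma clopen_in_compl:
  assumes "clopen_in X {x \<in> points X. p x}"
  shows "clopen_in X {x \<in> points X. \<not> p x}"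
proof -
  have "{x \<in> points X. \<not> p x} = points X - {x \<in> points X. p x}" by auto
  then show ?thesis
    using assms unfolding clopen_in_def by (auto intro: openin_diff closedin_diff)
qed

text \<open>The \<open>topspace\<close> of a generated topology is the union of its generators, and
  the box of the whole space already contains every closed chain.\<close>

lemma points_CC: "points (CC X) = closed_chains X"
proof -
  have "C \<in> chain_box X (points X)" if "C \<in> closed_chains X" for C
    using that closedin_subset by (auto simp: chain_box_def closed_chains_def)
  moreover have "clopen_in X (points X)"
    by (simp add: clopen_in_def)
  ultimately show ?thesis
    unfolding CC_def by (auto simp: chain_box_def chain_diamond_def)
qed

locale heyting_family =
  fixes I :: "'i set" and G :: "'i \<Rightarrow> 'a heyting"
  assumes heyting: "i \<in> I \<Longrightarrow> heyting_algebra (G i)"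
begin

abbreviation X :: "('i \<Rightarrow> 'a set) ordered_space" where
  "X \<equiv> ordered_product I (\<lambda>i. dual_space (G i))"

abbreviation T :: "nat \<Rightarrow> ('i \<Rightarrow> 'a set) set ordered_space" where
  "T n \<equiv> tensor_depth n I (\<lambda>i. dual_space (G i))"

abbreviation leX :: "('i \<Rightarrow> 'a set) \<Rightarrow> ('i \<Rightarrow> 'a set) \<Rightarrow> bool" where
  "leX \<equiv> ole X"

lemma otop_X: "otop X = product_topology (\<lambda>i. otop (dual_space (G i))) I"
  by (simp add: ordered_product_def)

lemma points_X: "x \<in> points X \<longleftrightarrow> (\<forall>i\<in>I. prime_filter (G i) (x i)) \<and> x \<in> extensional I"
proof -
  have "points (dual_space (G i)) = {P. prime_filter (G i) P}" if "i \<in> I" for i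
    using heyting_algebra.points_dual_space[OF heyting[OF that]] .
  then show ?thesis
    unfolding otop_X by (auto simp: PiE_iff)
qed

lemma leX_iff: "leX x y \<longleftrightarrow> (\<forall>i\<in>I. x i \<subseteq> y i)"
  by (simp add: ordered_product_def dual_space_def)

lemma leX_refl [simp]: "leX x x"
  by (simp add: leX_iff)

lemma leX_trans: "leX x y \<Longrightarrow> leX y z \<Longrightarrow> leX x z"
  unfolding leX_iff by (meson subset_trans)

lemma leX_antisym:
  assumes "leX x y" "leX y x" "x \<in> points X" "y \<in> points X"
  shows "x = y"
proof (rule extensionalityI[of _ I])
  show "x i = y i" if "i \<in> I" for i
    using assms(1,2) that unfolding leX_iff by blast
qed (use assms points_X in blast)+

lemma clopen_eval:
  assumes "i \<in> I" "a \<in> carrier (G i)"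
  shows "clopen_in X {x \<in> points X. a \<in> x i}"
proof -
  have pr: "continuous_map (otop X) (otop (dual_space (G i))) (\<lambda>x. x i)"
    unfolding otop_X by (rule continuous_map_product_projection[OF assms(1)])
  have "{x \<in> points X. a \<in> x i} = {x \<in> points X. x i \<in> stone_map (G i) a}"
    using assms(1) by (auto simp: points_X stone_map_def)
  then show ?thesis
    using heyting_algebra.clopen_stone_map[OF heyting[OF assms(1)] assms(2)] pr
    unfolding clopen_in_def by (auto intro: openin_continuous_map_preimage closedin_continuous_map_preimage)
qed

lemma clopen_not_eval:
  assumes "i \<in> I" "a \<in> carrier (G i)"
  shows "clopen_in X {x \<in> points X. a \<notin> x i}"
  using clopen_in_compl[OF clopen_eval[OF assms]] .

lemma compact_X: "compact_space (otop X)"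
  unfolding otop_X compact_space_product_topology
  using heyting heyting_algebra.compact_dual_space by blast

lemma Hausdorff_X: "Hausdorff_space (otop X)"
  unfolding otop_X Hausdorff_space_product_topology
  using heyting heyting_algebra.Hausdorff_dual_space by blast

text \<open>A principal upset is an intersection of clopen evaluation sets, one for each coordinate
  \<open>i\<close> and each element of \<open>x i\<close>. This serves the tails of closed chains
  that are not yet known to be finite.\<close>

lemma leX_closed:
  assumes "x \<in> points X"
  shows "closedin (otop X) {y \<in> points X. leX x y}"
proof -
  have "closedin (otop X) {y \<in> points X. \<forall>i\<in>I. \<forall>a\<in>x i. a \<in> y i}"
  proof (intro closedin_Collect_ball)
    fix i a assume i: "i \<in> I" "a \<in> x i"
    then have "a \<in> carrier (G i)"
      using heyting_algebra.prime_filterD(1)[OF heyting] assms points_X by blast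
    then show "closedin (otop X) {y \<in> points X. a \<in> y i}"
      using clopen_eval i by (simp add: clopen_in_def)
  qed
  moreover have "{y \<in> points X. \<forall>i\<in>I. \<forall>a\<in>x i. a \<in> y i} = {y \<in> points X. leX x y}"
    by (auto simp: leX_iff)
  ultimately show ?thesis
    by simp
qed

lemma clopen_separation:
  assumes "x \<in> points X" "finite D" "D \<subseteq> points X" "x \<notin> D"
  obtains V where "clopen_in X V" "x \<in> V" "V \<inter> D = {}"
proof -
  have "\<exists>V. clopen_in X V \<and> x \<in> V \<and> V \<inter> D = {}"
    using assms(2-4)
  proof (induction D)
    case empty
    then show ?case
      using assms(1) by (auto simp: clopen_in_def intro!: exI[of _ "points X"])
  next
    case (insert d D)
    then obtain V where V: "clopen_in X V" "x \<in> V" "V \<inter> D = {}" by auto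
    have d: "d \<in> points X" "x \<noteq> d"
      using insert.prems by auto
    obtain i where i: "i \<in> I" "x i \<noteq> d i"
      using extensionalityI[of x I d] d assms(1) points_X by blast
    then obtain a where a: "a \<in> carrier (G i)" "a \<in> x i \<longleftrightarrow> a \<notin> d i"
      using heyting_algebra.prime_filterD(1)[OF heyting[OF i(1)]] d(1) assms(1) points_X by blast
    define W where "W = {y \<in> points X. a \<in> y i \<longleftrightarrow> a \<in> x i}"
    have "clopen_in X W"
      using clopen_eval[OF i(1) a(1)] clopen_not_eval[OF i(1) a(1)] unfolding W_def by (cases "a \<in> x i") auto
    then have "clopen_in X (V \<inter> W)"
      using V(1) by (auto simp: clopen_in_def)
    moreover have "x \<in> V \<inter> W" "(V \<inter> W) \<inter> insert d D = {}"
      using V a(2) assms(1) by (auto simp: W_def)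
    ultimately show ?case
      by blast
  qed
  then show thesis
    using that by blast
qed

section \<open>Points of the tensor product\<close>

text \<open>Concrete form of the points of \<open>T n\<close>, as \<open>points_T\<close> shows.
  Closedness turns into finiteness, since finite sets are closed in the Hausdorff space
  \<open>X\<close>; the last clause says that the projections are upsets.\<close>

definition chains :: "nat \<Rightarrow> ('i \<Rightarrow> 'a set) set set" where
  "chains n = {C. C \<noteq> {} \<and> finite C \<and> card C \<le> n \<and> C \<subseteq> points X \<and>
     (\<forall>x\<in>C. \<forall>y\<in>C. leX x y \<or> leX y x) \<and>
     (\<forall>i\<in>I. \<forall>x\<in>C. \<forall>Q. prime_filter (G i) Q \<longrightarrow> x i \<subseteq> Q \<longrightarrow> (\<exists>y\<in>C. y i = Q))}"

definition up :: "('i \<Rightarrow> 'a set) set \<Rightarrow> ('i \<Rightarrow> 'a set) \<Rightarrow> ('i \<Rightarrow> 'a set) set" where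
  "up C x = {y \<in> C. leX x y}"

lemma finite_chain_min:
  assumes "finite C" "C \<noteq> {}" "\<And>x y. x \<in> C \<Longrightarrow> y \<in> C \<Longrightarrow> leX x y \<or> leX y x"
  obtains m where "m \<in> C" "\<And>y. y \<in> C \<Longrightarrow> leX m y"
proof -
  have "\<exists>m\<in>C. \<forall>y\<in>C. leX m y"
    using assms
  proof (induction C rule: finite_ne_induct)
    case (insert x C)
    then obtain m where m: "m \<in> C" "\<forall>y\<in>C. leX m y" by auto
    have "leX x m \<or> leX m x"
      using insert.prems[of x m] m(1) by simp
    then show ?case
    proof
      assume "leX x m"
      then have "\<forall>y\<in>insert x C. leX x y"
        using m(2) leX_trans[of x m] by auto
      then show ?thesis by blast
    next
      assume "leX m x"
      then have "\<forall>y\<in>insert x C. leX m y"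
        using m(2) by auto
      then show ?thesis
        using m(1) by blast
    qed
  qed auto
  then show thesis
    using that by blast
qed

lemma points_tensor:
  "C \<in> points (tensor I (\<lambda>i. dual_space (G i))) \<longleftrightarrow>
     C \<noteq> {} \<and> closedin (otop X) C \<and> (\<forall>x\<in>C. \<forall>y\<in>C. leX x y \<or> leX y x) \<and>
     (\<forall>i\<in>I. \<forall>x\<in>C. \<forall>Q. prime_filter (G i) Q \<longrightarrow> x i \<subseteq> Q \<longrightarrow> (\<exists>y\<in>C. y i = Q))"
proof -
  have "upset_of (ole (dual_space (G i))) (points (dual_space (G i))) ((\<lambda>y. y i) ` C) \<longleftrightarrow>
      (\<forall>x\<in>C. \<forall>Q. prime_filter (G i) Q \<longrightarrow> x i \<subseteq> Q \<longrightarrow> (\<exists>y\<in>C. y i = Q))"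
    if i: "i \<in> I" and C: "C \<subseteq> points X" for i
  proof -
    have "(\<lambda>y. y i) ` C \<subseteq> {P. prime_filter (G i) P}"
      using C i points_X by blast
    then show ?thesis
      unfolding upset_of_def heyting_algebra.points_dual_space[OF heyting[OF i]]
        heyting_algebra.ole_dual_space[OF heyting[OF i]]
      unfolding image_iff mem_Collect_eq ball_simps by (metis (full_types))
  qed
  note * = this
  have "points (tensor I (\<lambda>i. dual_space (G i))) = {C \<in> closed_chains X.
         \<forall>i\<in>I. upset_of (ole (dual_space (G i))) (points (dual_space (G i))) ((\<lambda>y. y i) ` C)}"
    unfolding tensor_def ordered_subspace_def using points_CC[of X] by auto
  moreover have "C \<subseteq> points X" if "closedin (otop X) C"
    using closedin_subset[OF that] .
  ultimately show ?thesis
    using * by (auto simp: closed_chains_def Complete_Partial_Order.chain_def)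
qed

lemma ole_tensor: "ole (tensor I (\<lambda>i. dual_space (G i))) C D \<longleftrightarrow> upset_of leX C D"
  by (simp add: tensor_def ordered_subspace_def CC_def)

text \<open>Let \<open>y\<close> in \<open>C\<close> project to a prime filter \<open>Q\<close>
  above \<open>x i\<close>. Either \<open>y\<close> lies above \<open>x\<close> and hence in
  \<open>D\<close>, or it lies below \<open>x\<close>; in that case \<open>y i = x i\<close>, so
  \<open>x\<close> itself projects to \<open>Q\<close>.\<close>

lemma upset_in_tensor:
  assumes C: "C \<in> points (tensor I (\<lambda>i. dual_space (G i)))"
    and D: "upset_of leX C D" "D \<noteq> {}" "closedin (otop X) D"
  shows "D \<in> points (tensor I (\<lambda>i. dual_space (G i)))"
  unfolding points_tensor
proof (intro conjI ballI allI impI)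
  have sub: "D \<subseteq> C" and up: "\<And>x y. x \<in> D \<Longrightarrow> y \<in> C \<Longrightarrow> leX x y \<Longrightarrow> y \<in> D"
    using D(1) unfolding upset_of_def by auto
  have tot: "\<And>x y. x \<in> C \<Longrightarrow> y \<in> C \<Longrightarrow> leX x y \<or> leX y x"
    using C unfolding points_tensor by blast
  show "leX x y \<or> leX y x" if "x \<in> D" "y \<in> D" for x y
    using that sub tot by blast
  fix i x Q assume i: "i \<in> I" and x: "x \<in> D" and Q: "prime_filter (G i) Q" "x i \<subseteq> Q"
  obtain y where y: "y \<in> C" "y i = Q"
    using C[unfolded points_tensor] i subsetD[OF sub x] Q by meson
  show "\<exists>y\<in>D. y i = Q"
  proof (cases "leX x y")
    case True
    then show ?thesis
      using up[OF x y(1)] y(2) by blast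
  next
    case False
    then have "leX y x"
      using tot[of x y] x y sub by auto
    then have "y i \<subseteq> x i"
      using i by (simp add: leX_iff)
    then show ?thesis
      using Q(2) x y(2) by blast
  qed
qed (use D in auto)

lemma upset_eq_up:
  assumes D: "upset_of leX C D" "D \<noteq> {}" and C: "finite C" "\<And>x y. x \<in> C \<Longrightarrow> y \<in> C \<Longrightarrow> leX x y \<or> leX y x"
  obtains x where "x \<in> C" "D = up C x"
proof -
  have sub: "D \<subseteq> C" and up: "\<And>x y. x \<in> D \<Longrightarrow> y \<in> C \<Longrightarrow> leX x y \<Longrightarrow> y \<in> D"
    using D(1) by (auto simp: upset_of_def)
  obtain m where m: "m \<in> D" "\<And>y. y \<in> D \<Longrightarrow> leX m y"
    using finite_chain_min[of D] finite_subset[OF sub C(1)] D(2) C(2) sub by blast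
  have "D = up C m"
    using m sub up[OF m(1)] by (auto simp: up_def)
  then show thesis
    using that m sub by blast
qed

lemma up_upset: "upset_of leX C (up C x)"
  using leX_trans by (auto simp: upset_of_def up_def)

lemma inj_on_up:
  assumes "C \<subseteq> points X"
  shows "inj_on (up C) C"
proof (rule inj_onI)
  fix x y assume xy: "x \<in> C" "y \<in> C" "up C x = up C y"
  have "x \<in> up C x" "y \<in> up C y"
    using xy(1,2) by (simp_all add: up_def)
  then have "x \<in> up C y" "y \<in> up C x"
    unfolding xy(3) by simp_all
  then have "leX x y" "leX y x"
    unfolding up_def by simp_all
  then show "x = y"
    using leX_antisym[of x y] assms xy(1,2) by auto
qed

text \<open>The tails \<open>up C x\<close> embed \<open>C\<close> into the set of points above it,
  so finite depth forces \<open>C\<close> to be finite. For finite \<open>C\<close> every nonempty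
  upset is a tail, so the two cardinalities agree.\<close>

lemma depth_le_tensor:
  assumes C: "C \<in> points (tensor I (\<lambda>i. dual_space (G i)))"
  shows "depth_le (tensor I (\<lambda>i. dual_space (G i))) n C \<longleftrightarrow> finite C \<and> card C \<le> n"
proof -
  let ?A = "{D \<in> points (tensor I (\<lambda>i. dual_space (G i))). upset_of leX C D}"
  have Cc: "closedin (otop X) C" and Cp: "C \<subseteq> points X"
    and tot: "\<And>x y. x \<in> C \<Longrightarrow> y \<in> C \<Longrightarrow> leX x y \<or> leX y x"
    using C closedin_subset[of "otop X" C] unfolding points_tensor by simp_all
  have "up C x \<in> ?A" if "x \<in> C" for x
  proof -
    have "up C x = C \<inter> {y \<in> points X. leX x y}"
      using Cp by (auto simp: up_def)
    then have "closedin (otop X) (up C x)"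
      using leX_closed[of x] that Cp Cc by (auto intro!: closedin_Int)
    moreover have "up C x \<noteq> {}"
      using that by (auto simp: up_def)
    ultimately show ?thesis
      using upset_in_tensor[OF C up_upset] up_upset by auto
  qed
  then have sub: "up C ` C \<subseteq> ?A" by auto
  have "finite ?A \<and> card ?A \<le> n \<longleftrightarrow> finite C \<and> card C \<le> n"
  proof
    assume A: "finite ?A \<and> card ?A \<le> n"
    then have "finite (up C ` C)"
      using sub finite_subset by auto
    then have "finite C"
      using inj_on_up[OF Cp] finite_imageD by auto
    moreover have "card C \<le> card ?A"
      using card_mono[OF _ sub] A card_image[OF inj_on_up[OF Cp]] by simp
    ultimately show "finite C \<and> card C \<le> n"
      using A by simp
  next
    assume fin: "finite C \<and> card C \<le> n"
    have "?A \<subseteq> up C ` C"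
    proof
      fix D assume D: "D \<in> ?A"
      then have "D \<noteq> {}"
        by (simp add: points_tensor)
      then obtain x where "x \<in> C" "D = up C x"
        using upset_eq_up[of C D] D fin tot by auto
      then show "D \<in> up C ` C" by auto
    qed
    then have "finite ?A" "card ?A \<le> card C"
      using fin finite_subset[of ?A "up C ` C"] surj_card_le[of C ?A "up C"] by auto
    then show "finite ?A \<and> card ?A \<le> n"
      using fin by simp
  qed
  then show ?thesis
    by (simp add: depth_le_def ole_tensor)
qed

lemma chains_eq:
  "chains n = {C \<in> points (tensor I (\<lambda>i. dual_space (G i))). finite C \<and> card C \<le> n}"
proof -
  have "closedin (otop X) C \<longleftrightarrow> C \<subseteq> points X" if "finite C" for C
    using closedin_Hausdorff_finite_eq[OF Hausdorff_X that] .
  then show ?thesis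
    unfolding chains_def points_tensor by auto
qed

lemma points_T: "points (T n) = chains n"
  unfolding tensor_depth_def ordered_subspace_def chains_eq using depth_le_tensor by auto

lemma ole_T: "ole (T n) C D \<longleftrightarrow> upset_of leX C D"
  by (simp add: tensor_depth_def ordered_subspace_def ole_tensor)

lemma chainsD:
  assumes "C \<in> chains n"
  shows "C \<noteq> {}" "finite C" "card C \<le> n" "C \<subseteq> points X"
    "\<And>x y. x \<in> C \<Longrightarrow> y \<in> C \<Longrightarrow> leX x y \<or> leX y x"
    "\<And>i x Q. i \<in> I \<Longrightarrow> x \<in> C \<Longrightarrow> prime_filter (G i) Q \<Longrightarrow> x i \<subseteq> Q \<Longrightarrow> \<exists>y\<in>C. y i = Q"
  using assms unfolding chains_def by auto

lemma upset_in_chains: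
  assumes "C \<in> chains n" "upset_of leX C D" "D \<noteq> {}"
  shows "D \<in> chains n"
proof -
  note C = chainsD[OF assms(1)]
  have sub: "D \<subseteq> C"
    using assms(2) by (simp add: upset_of_def)
  have fin: "finite D" "card D \<le> n"
    using finite_subset[OF sub C(2)] card_mono[OF C(2) sub] C(3) by auto
  then have "closedin (otop X) D"
    using closedin_Hausdorff_finite_eq[OF Hausdorff_X] sub C(4) by auto
  then show ?thesis
    using upset_in_tensor[of C D] assms fin unfolding chains_eq by auto
qed

lemma up_in_chains:
  assumes "C \<in> chains n" "x \<in> C"
  shows "up C x \<in> chains n"
proof -
  have "x \<in> up C x"
    using assms(2) by (simp add: up_def)
  then show ?thesis
    using upset_in_chains[OF assms(1) up_upset, of x] by auto
qed

lemma chains_upsetE: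
  assumes "C \<in> chains n" "D \<in> chains n" "upset_of leX C D"
  obtains x where "x \<in> C" "D = up C x"
  using upset_eq_up[OF assms(3)] chainsD[OF assms(1)] chainsD(1)[OF assms(2)] by blast

section \<open>Topology of the tensor product\<close>

lemma otop_T: "otop (T n) = subtopology (otop (CC X)) (chains n)"
proof -
  have "{C \<in> points (tensor I (\<lambda>i. dual_space (G i))). depth_le (tensor I (\<lambda>i. dual_space (G i))) n C} = chains n"
    using depth_le_tensor chains_eq by auto
  moreover have "chains n \<subseteq> {C \<in> closed_chains X.
      \<forall>i\<in>I. upset_of (ole (dual_space (G i))) (points (dual_space (G i))) ((\<lambda>y. y i) ` C)}"
    unfolding chains_eq by (auto simp: tensor_def ordered_subspace_def)
  ultimately show ?thesis
    by (simp add: tensor_depth_def ordered_subspace_def tensor_def subtopology_subtopology Int_absorb1)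
qed

lemma chains_closed_chain: "C \<in> chains n \<Longrightarrow> C \<in> closed_chains X"
  unfolding chains_eq by (auto simp: points_tensor closed_chains_def Complete_Partial_Order.chain_def)

text \<open>Boxes and diamonds are open by definition, and the complement of either is the other
  kind of set for \<open>points X - V\<close>.\<close>

lemma clopen_box:
  assumes "clopen_in X V"
  shows "clopen_in (T n) {C \<in> points (T n). C \<subseteq> V}" and "clopen_in (T n) {C \<in> points (T n). C \<inter> V \<noteq> {}}"
proof -
  have "openin (otop (T n)) {C \<in> points (T n). C \<subseteq> W} \<and> openin (otop (T n)) {C \<in> points (T n). C \<inter> W \<noteq> {}}"
    if W: "clopen_in X W" for W
  proof -
    have "openin (otop (CC X)) (chain_box X W)" "openin (otop (CC X)) (chain_diamond X W)"
      using W unfolding CC_def by (auto intro!: topology_generated_by_Basis)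
    moreover have "{C \<in> points (T n). C \<subseteq> W} = chain_box X W \<inter> chains n"
      "{C \<in> points (T n). C \<inter> W \<noteq> {}} = chain_diamond X W \<inter> chains n"
      using chains_closed_chain by (auto simp: points_T chain_box_def chain_diamond_def)
    ultimately show ?thesis
      unfolding otop_T openin_subtopology by auto
  qed
  note op = this
  have V': "clopen_in X (points X - V)"
    using assms by (auto simp: clopen_in_def)
  have "points (T n) - {C \<in> points (T n). C \<subseteq> V} = {C \<in> points (T n). C \<inter> (points X - V) \<noteq> {}}"
    "points (T n) - {C \<in> points (T n). C \<inter> V \<noteq> {}} = {C \<in> points (T n). C \<subseteq> points X - V}"
    using chainsD(4) by (auto simp: points_T)
  then show "clopen_in (T n) {C \<in> points (T n). C \<subseteq> V}" and "clopen_in (T n) {C \<in> points (T n). C \<inter> V \<noteq> {}}"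
    using op[OF assms] op[OF V'] unfolding clopen_in_def closedin_def by auto
qed

lemma continuous_map_T:
  assumes "f \<in> topspace Z \<rightarrow> chains n"
    and "\<And>V. clopen_in X V \<Longrightarrow> openin Z {z \<in> topspace Z. f z \<subseteq> V}"
    and "\<And>V. clopen_in X V \<Longrightarrow> openin Z {z \<in> topspace Z. f z \<inter> V \<noteq> {}}"
  shows "continuous_map Z (otop (T n)) f"
proof -
  have cc: "f z \<in> closed_chains X" if "z \<in> topspace Z" for z
    using that assms(1) chains_closed_chain by auto
  have "continuous_map Z (otop (CC X)) f"
    unfolding CC_def ordered_space.simps
  proof (rule continuous_on_generated_topo)
    fix U assume "U \<in> {chain_box X V |V. clopen_in X V} \<union> {chain_diamond X V |V. clopen_in X V}"
    then obtain V where V: "clopen_in X V" "U = chain_box X V \<or> U = chain_diamond X V" by auto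
    have "f -` chain_box X V \<inter> topspace Z = {z \<in> topspace Z. f z \<subseteq> V}"
      "f -` chain_diamond X V \<inter> topspace Z = {z \<in> topspace Z. f z \<inter> V \<noteq> {}}"
      using cc by (auto simp: chain_box_def chain_diamond_def)
    then show "openin Z (f -` U \<inter> topspace Z)"
      using V assms(2,3) by auto
  next
    show "f ` topspace Z \<subseteq> \<Union>({chain_box X V |V. clopen_in X V} \<union> {chain_diamond X V |V. clopen_in X V})"
      using cc points_CC[of X] by (auto simp: CC_def)
  qed
  then show ?thesis
    unfolding otop_T continuous_map_in_subtopology using assms(1) by simp
qed

lemma Hausdorff_T: "Hausdorff_space (otop (T n))"
proof -
  have *: "\<exists>U V. openin (otop (T n)) U \<and> openin (otop (T n)) V \<and> C \<in> U \<and> D \<in> V \<and> disjnt U V"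
    if C: "C \<in> chains n" and D: "D \<in> chains n" and x: "x \<in> C" "x \<notin> D" for C D x
  proof -
    obtain V where V: "clopen_in X V" "x \<in> V" "V \<inter> D = {}"
      using clopen_separation[of x D] chainsD[OF C] chainsD[OF D] x by blast
    have V': "clopen_in X (points X - V)"
      using V(1) by (auto simp: clopen_in_def)
    have "C \<in> {C \<in> points (T n). C \<inter> V \<noteq> {}}" "D \<in> {C \<in> points (T n). C \<subseteq> points X - V}"
      using C D V(2,3) x chainsD(4)[OF D] by (auto simp: points_T)
    moreover have "disjnt {C \<in> points (T n). C \<inter> V \<noteq> {}} {C \<in> points (T n). C \<subseteq> points X - V}"
      by (auto simp: disjnt_def)
    ultimately show ?thesis
      using clopen_box(2)[OF V(1), of n] clopen_box(1)[OF V', of n] unfolding clopen_in_def by blast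
  qed
  show ?thesis
    unfolding Hausdorff_space_def points_T
  proof (intro allI impI)
    fix C D assume CD: "C \<in> chains n \<and> D \<in> chains n \<and> C \<noteq> D"
    then consider x where "x \<in> C" "x \<notin> D" | x where "x \<in> D" "x \<notin> C" by blast
    then show "\<exists>U V. openin (otop (T n)) U \<and> openin (otop (T n)) V \<and> C \<in> U \<and> D \<in> V \<and> disjnt U V"
    proof cases
      case 1
      then show ?thesis
        using * CD by auto
    next
      case 2
      then show ?thesis
        using *[of D C x] CD disjnt_sym by metis
    qed
  qed
qed

section \<open>Sorted tuples enumerating the chains\<close>

abbreviation XN :: "nat \<Rightarrow> (nat \<Rightarrow> 'i \<Rightarrow> 'a set) topology" where
  "XN n \<equiv> product_topology (\<lambda>_. otop X) {..<n}"

text \<open>Repeated entries are allowed, so the one exponent \<open>n\<close> serves chains of all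
  sizes from 1 to \<open>n\<close>. Sorting makes the nonempty tails of a tuple exactly the nonempty
  upsets of its chain.\<close>

definition tuples :: "nat \<Rightarrow> (nat \<Rightarrow> 'i \<Rightarrow> 'a set) set" where
  "tuples n = {s \<in> topspace (XN n). (\<forall>k<n. \<forall>j\<le>k. leX (s j) (s k)) \<and> s ` {..<n} \<in> chains n}"

text \<open>Induction on \<open>n\<close>: the least point comes first, and the shorter tuple
  enumerates the rest. A singleton is enumerated by a constant tuple, which absorbs any slack in
  \<open>card C \<le> n\<close>.\<close>

lemma finite_chain_enumeration:
  assumes "finite C" "C \<noteq> {}" "card C \<le> n" "\<And>x y. x \<in> C \<Longrightarrow> y \<in> C \<Longrightarrow> leX x y \<or> leX y x"
  obtains s where "s ` {..<n} = C" "\<And>j k. k < n \<Longrightarrow> j \<le> k \<Longrightarrow> leX (s j) (s k)"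
proof -
  have "\<exists>s. s ` {..<n} = C \<and> (\<forall>k<n. \<forall>j\<le>k. leX (s j) (s k))"
    using assms
  proof (induction n arbitrary: C)
    case 0
    then show ?case by simp
  next
    case (Suc n)
    obtain m where m: "m \<in> C" "\<And>y. y \<in> C \<Longrightarrow> leX m y"
      using finite_chain_min[of C] Suc.prems by metis
    show ?case
    proof (cases "C = {m}")
      case True
      then show ?thesis
        by (intro exI[of _ "\<lambda>_. m"]) auto
    next
      case False
      then have "C - {m} \<noteq> {}"
        using m(1) by blast
      moreover have "finite (C - {m})" "card (C - {m}) \<le> n"
        using Suc.prems(1,3) m(1) by auto
      moreover have "\<And>x y. x \<in> C - {m} \<Longrightarrow> y \<in> C - {m} \<Longrightarrow> leX x y \<or> leX y x"
        using Suc.prems(4) by auto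
      ultimately obtain s where s: "s ` {..<n} = C - {m}" "\<forall>k<n. \<forall>j\<le>k. leX (s j) (s k)"
        using Suc.IH[of "C - {m}"] by auto
      define t where "t = (\<lambda>k. case k of 0 \<Rightarrow> m | Suc k \<Rightarrow> s k)"
      have "t ` {..<Suc n} = insert m (s ` {..<n})"
        unfolding lessThan_Suc_eq_insert_0 by (simp add: t_def image_image)
      then have 1: "t ` {..<Suc n} = C"
        using s(1) m(1) by auto
      have "leX (t j) (t k)" if "k < Suc n" "j \<le> k" for j k
      proof (cases j)
        case 0
        have "t k \<in> C"
          using 1 that by auto
        then show ?thesis
          using m(2) 0 by (simp add: t_def)
      next
        case (Suc j')
        then show ?thesis
          using that s(2) by (cases k) (auto simp: t_def)
      qed
      then show ?thesis
        using 1 by blast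
    qed
  qed
  then show thesis
    using that by blast
qed

lemma XN_coordinate:
  assumes "s \<in> topspace (XN n)" "j < n"
  shows "s j \<in> points X"
  using assms by (auto simp: PiE_iff)

lemma clopen_coordinate:
  assumes "j < n" "clopen_in X V"
  shows "openin (XN n) {s \<in> topspace (XN n). s j \<in> V}" "closedin (XN n) {s \<in> topspace (XN n). s j \<in> V}"
proof -
  have "continuous_map (XN n) (otop X) (\<lambda>s. s j)"
    using continuous_map_product_projection[of j "{..<n}" "\<lambda>_. otop X"] assms(1) by simp
  then show "openin (XN n) {s \<in> topspace (XN n). s j \<in> V}" "closedin (XN n) {s \<in> topspace (XN n). s j \<in> V}"
    using assms(2) openin_continuous_map_preimage closedin_continuous_map_preimage
    unfolding clopen_in_def by blast+
qed

lemma closedin_eval: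
  assumes "j < n" "i \<in> I" "a \<in> carrier (G i)"
  shows "closedin (XN n) {s \<in> topspace (XN n). a \<in> s j i}"
    "closedin (XN n) {s \<in> topspace (XN n). a \<notin> s j i}"
proof -
  have "{s \<in> topspace (XN n). a \<in> s j i} = {s \<in> topspace (XN n). s j \<in> {x \<in> points X. a \<in> x i}}"
    "{s \<in> topspace (XN n). a \<notin> s j i} = {s \<in> topspace (XN n). s j \<in> {x \<in> points X. a \<notin> x i}}"
    using XN_coordinate[OF _ assms(1)] by auto
  then show "closedin (XN n) {s \<in> topspace (XN n). a \<in> s j i}"
    "closedin (XN n) {s \<in> topspace (XN n). a \<notin> s j i}"
    using clopen_coordinate(2)[OF assms(1) clopen_eval[OF assms(2,3)]]
      clopen_coordinate(2)[OF assms(1) clopen_not_eval[OF assms(2,3)]] by simp_all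
qed

text \<open>The projections of a finite chain \<open>C\<close> are upsets iff this holds for every \<open>a\<close>, \<open>b\<close>: whenever
  \<open>a \<Rrightarrow> b\<close> fails at some point of \<open>C\<close>, then some point of \<open>C\<close> contains \<open>a\<close> and omits \<open>b\<close>. Each
  instance is a clopen condition on tuples, which is what makes the set of tuples closed.\<close>

lemma projection_upset_iff:
  assumes C: "finite C" "C \<subseteq> points X" and i: "i \<in> I"
  shows "(\<forall>x\<in>C. \<forall>Q. prime_filter (G i) Q \<longrightarrow> x i \<subseteq> Q \<longrightarrow> (\<exists>y\<in>C. y i = Q)) \<longleftrightarrow>
    (\<forall>a\<in>carrier (G i). \<forall>b\<in>carrier (G i). \<forall>x\<in>C. (a \<Rrightarrow>\<^bsub>G i\<^esub> b) \<notin> x i \<longrightarrow> (\<exists>y\<in>C. a \<in> y i \<and> b \<notin> y i))"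
    (is "?L \<longleftrightarrow> ?R")
proof -
  interpret heyting_algebra "G i"
    using heyting[OF i] .
  have pf: "prime_filter (G i) (x i)" if "x \<in> C" for x
    using that C(2) i points_X by blast
  show ?thesis
  proof
    assume L: ?L
    show ?R
    proof (intro ballI impI)
      fix a b x assume ab: "a \<in> carrier (G i)" "b \<in> carrier (G i)" and x: "x \<in> C" "(a \<Rrightarrow>\<^bsub>G i\<^esub> b) \<notin> x i"
      obtain Q where Q: "prime_filter (G i) Q" "x i \<subseteq> Q" "a \<in> Q" "b \<notin> Q"
        using imp_notin_prime_filter[OF pf[OF x(1)] ab x(2)] .
      then obtain y where "y \<in> C" "y i = Q"
        using L x(1) by meson
      then show "\<exists>y\<in>C. a \<in> y i \<and> b \<notin> y i"
        using Q(3,4) by auto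
    qed
  next
    assume R: ?R
    show ?L
    proof (intro ballI allI impI, rule ccontr)
      fix x Q assume x: "x \<in> C" and Q: "prime_filter (G i) Q" "x i \<subseteq> Q" and no: "\<not> (\<exists>y\<in>C. y i = Q)"
      have 1: "finite ((\<lambda>y. y i) ` C)" "Q \<notin> (\<lambda>y. y i) ` C"
        using C(1) no by auto
      have 2: "prime_filter (G i) P" if "P \<in> (\<lambda>y. y i) ` C" for P
        using that pf by auto
      \<comment> \<open>Since \<open>C\<close> is finite, one pair separates \<open>Q\<close> from
        all projections at once.\<close>
      obtain a b where ab: "a \<in> Q" "b \<in> carrier (G i) - Q" "\<And>P. P \<in> (\<lambda>y. y i) ` C \<Longrightarrow> a \<in> P \<Longrightarrow> b \<in> P"
        using finite_separation[OF 1(1) 2 Q(1) 1(2)] by metis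
      have a: "a \<in> carrier (G i)"
        using ab(1) prime_filterD(1)[OF Q(1)] by auto
      have "(a \<Rrightarrow>\<^bsub>G i\<^esub> b) \<notin> x i"
        using imp_in_prime_filter[OF pf[OF x] a, of b] ab(1,2) Q by auto
      then have "\<exists>y\<in>C. a \<in> y i \<and> b \<notin> y i"
        using R a ab(2) x by auto
      then show False
        using ab(3) by auto
    qed
  qed
qed

text \<open>Both conditions are phrased through single elements of the algebras, so every instance
  constrains finitely many coordinates by evaluation sets. The assumption \<open>0 < n\<close> makes
  the enumerated set nonempty.\<close>

lemma tuples_iff:
  assumes "s \<in> topspace (XN n)" "0 < n"
  shows "s \<in> tuples n \<longleftrightarrow>
    (\<forall>k\<in>{..<n}. \<forall>j\<in>{..k}. \<forall>i\<in>I. \<forall>a\<in>carrier (G i). a \<in> s j i \<longrightarrow> a \<in> s k i) \<and>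
    (\<forall>i\<in>I. \<forall>a\<in>carrier (G i). \<forall>b\<in>carrier (G i). \<forall>j\<in>{..<n}.
       (a \<Rrightarrow>\<^bsub>G i\<^esub> b) \<notin> s j i \<longrightarrow> (\<exists>k\<in>{..<n}. a \<in> s k i \<and> b \<notin> s k i))"
proof -
  have pts: "s ` {..<n} \<subseteq> points X"
    using XN_coordinate[OF assms(1)] by auto
  have sub: "s j i \<subseteq> carrier (G i)" if "j < n" "i \<in> I" for i j
    using heyting_algebra.prime_filterD(1)[OF heyting[OF that(2)]] XN_coordinate[OF assms(1) that(1)] that(2) points_X
    by blast
  have mono: "(\<forall>k\<in>{..<n}. \<forall>j\<in>{..k}. \<forall>i\<in>I. \<forall>a\<in>carrier (G i). a \<in> s j i \<longrightarrow> a \<in> s k i)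
      \<longleftrightarrow> (\<forall>k<n. \<forall>j\<le>k. leX (s j) (s k))" (is "?A \<longleftrightarrow> ?B")
  proof
    assume A: ?A
    show ?B
      unfolding leX_iff
    proof (intro allI impI ballI subsetI)
      fix k j i a assume "k < n" "j \<le> k" "i \<in> I" "a \<in> s j i"
      then show "a \<in> s k i"
        using A sub[of j i] by auto
    qed
  next
    assume ?B
    then show ?A
      unfolding leX_iff by auto
  qed
  have fin: "finite (s ` {..<n})" "s ` {..<n} \<noteq> {}" "card (s ` {..<n}) \<le> n"
    using assms(2) card_image_le[of "{..<n}" s] by auto
  have tot: "\<forall>x\<in>s ` {..<n}. \<forall>y\<in>s ` {..<n}. leX x y \<or> leX y x" if "\<forall>k<n. \<forall>j\<le>k. leX (s j) (s k)"
    using that by (auto, meson nat_le_linear)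
  have ch: "s ` {..<n} \<in> chains n \<longleftrightarrow> (\<forall>x\<in>s ` {..<n}. \<forall>y\<in>s ` {..<n}. leX x y \<or> leX y x) \<and>
     (\<forall>i\<in>I. \<forall>x\<in>s ` {..<n}. \<forall>Q. prime_filter (G i) Q \<longrightarrow> x i \<subseteq> Q \<longrightarrow> (\<exists>y\<in>s ` {..<n}. y i = Q))"
    unfolding chains_def using fin pts by auto
  have "s \<in> tuples n \<longleftrightarrow> (\<forall>k<n. \<forall>j\<le>k. leX (s j) (s k)) \<and>
     (\<forall>i\<in>I. \<forall>x\<in>s ` {..<n}. \<forall>Q. prime_filter (G i) Q \<longrightarrow> x i \<subseteq> Q \<longrightarrow> (\<exists>y\<in>s ` {..<n}. y i = Q))"
  proof (cases "\<forall>k<n. \<forall>j\<le>k. leX (s j) (s k)")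
    case True
    show ?thesis
      unfolding tuples_def mem_Collect_eq ch using assms(1) True tot[OF True] by argo
  next
    case False
    then show ?thesis
      unfolding tuples_def mem_Collect_eq by argo
  qed
  also have "\<dots> \<longleftrightarrow> (\<forall>k<n. \<forall>j\<le>k. leX (s j) (s k)) \<and>
     (\<forall>i\<in>I. \<forall>a\<in>carrier (G i). \<forall>b\<in>carrier (G i). \<forall>x\<in>s ` {..<n}. (a \<Rrightarrow>\<^bsub>G i\<^esub> b) \<notin> x i \<longrightarrow> (\<exists>y\<in>s ` {..<n}. a \<in> y i \<and> b \<notin> y i))"
    using projection_upset_iff[OF fin(1) pts] by (simp cong: ball_cong)
  finally show ?thesis
    unfolding mono by simp
qed

lemma closed_tuples: "closedin (XN n) (tuples n)"
proof (cases "n = 0")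
  case True
  then have "tuples n = {}"
    by (auto simp: tuples_def chains_def)
  then show ?thesis by simp
next
  case False
  \<comment> \<open>Closedness is propagated through the connectives. Evaluation sets are clopen, so
    premises of implications cause no trouble, and the existential quantifier ranges over a finite
    set.\<close>
  have imp: "closedin (XN n) {s \<in> topspace (XN n). p s \<longrightarrow> q s}"
    if "closedin (XN n) {s \<in> topspace (XN n). \<not> p s}" "closedin (XN n) {s \<in> topspace (XN n). q s}" for p q
  proof -
    have "{s \<in> topspace (XN n). p s \<longrightarrow> q s} = {s \<in> topspace (XN n). \<not> p s} \<union> {s \<in> topspace (XN n). q s}"
      by auto
    then show ?thesis
      using that by (simp only: closedin_Un)
  qed
  have ex: "closedin (XN n) {s \<in> topspace (XN n). \<exists>k\<in>{..<n}. p k s}"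
    if "\<And>k. k < n \<Longrightarrow> closedin (XN n) {s \<in> topspace (XN n). p k s}" for p
  proof -
    have "{s \<in> topspace (XN n). \<exists>k\<in>{..<n}. p k s} = (\<Union>k\<in>{..<n}. {s \<in> topspace (XN n). p k s})"
      by auto
    moreover have "closedin (XN n) (\<Union>k\<in>{..<n}. {s \<in> topspace (XN n). p k s})"
      using that by (intro closedin_Union) auto
    ultimately show ?thesis by simp
  qed
  have conj: "closedin (XN n) {s \<in> topspace (XN n). p s \<and> q s}"
    if "closedin (XN n) {s \<in> topspace (XN n). p s}" "closedin (XN n) {s \<in> topspace (XN n). q s}" for p q
  proof -
    have "{s \<in> topspace (XN n). p s \<and> q s} = {s \<in> topspace (XN n). p s} \<inter> {s \<in> topspace (XN n). q s}"
      by auto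
    then show ?thesis
      using that by (simp only: closedin_Int)
  qed
  have "tuples n = {s \<in> topspace (XN n).
    (\<forall>k\<in>{..<n}. \<forall>j\<in>{..k}. \<forall>i\<in>I. \<forall>a\<in>carrier (G i). a \<in> s j i \<longrightarrow> a \<in> s k i) \<and>
    (\<forall>i\<in>I. \<forall>a\<in>carrier (G i). \<forall>b\<in>carrier (G i). \<forall>j\<in>{..<n}.
       (a \<Rrightarrow>\<^bsub>G i\<^esub> b) \<notin> s j i \<longrightarrow> (\<exists>k\<in>{..<n}. a \<in> s k i \<and> b \<notin> s k i))}" (is "_ = ?S")
  proof (intro subset_antisym subsetI)
    fix s assume s: "s \<in> tuples n"
    then have "s \<in> topspace (XN n)"
      unfolding tuples_def by (elim CollectE conjE)
    with s show "s \<in> ?S"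
      using tuples_iff False by blast
  next
    fix s assume s: "s \<in> ?S"
    then have "s \<in> topspace (XN n)"
      by (elim CollectE conjE)
    with s show "s \<in> tuples n"
      using tuples_iff False by blast
  qed
  also have "closedin (XN n) \<dots>"
  proof (intro conj closedin_Collect_ball imp)
    fix k j i a assume "k \<in> {..<n}" "j \<in> {..k}" "i \<in> I" "a \<in> carrier (G i)"
    then show "closedin (XN n) {s \<in> topspace (XN n). a \<notin> s j i}" "closedin (XN n) {s \<in> topspace (XN n). a \<in> s k i}"
      by (simp_all only: closedin_eval lessThan_iff atMost_iff le_less_trans)
  next
    fix i a b j assume i: "i \<in> I" and ab: "a \<in> carrier (G i)" "b \<in> carrier (G i)" and j: "j \<in> {..<n}"
    have "(a \<Rrightarrow>\<^bsub>G i\<^esub> b) \<in> carrier (G i)"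
      using heyting_algebra.imp_closed[OF heyting[OF i] ab] .
    then show "closedin (XN n) {s \<in> topspace (XN n). \<not> (a \<Rrightarrow>\<^bsub>G i\<^esub> b) \<notin> s j i}"
      using closedin_eval(1)[of j n i] i j by (simp only: not_not lessThan_iff)
    show "closedin (XN n) {s \<in> topspace (XN n). \<exists>k\<in>{..<n}. a \<in> s k i \<and> b \<notin> s k i}"
      using closedin_eval i ab by (intro ex conj)
  qed
  finally show ?thesis .
qed

section \<open>The tuple space and its quotient map onto \<open>T n\<close>\<close>

abbreviation "TN n \<equiv> subtopology (XN n) (tuples n)"

lemma topspace_TN: "topspace (TN n) = tuples n"
  using closedin_subset[OF closed_tuples] by (simp only: topspace_subtopology Int_absorb1)

lemma compact_TN: "compact_space (TN n)"
proof -
  have "compact_space (XN n)"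
    unfolding compact_space_product_topology using compact_X by simp
  then show ?thesis
    using closedin_compact_space closed_tuples compact_space_subtopology by blast
qed

lemma tuplesD:
  assumes "s \<in> tuples n"
  shows "s \<in> topspace (XN n)" "\<And>j k. k < n \<Longrightarrow> j \<le> k \<Longrightarrow> leX (s j) (s k)" "s ` {..<n} \<in> chains n"
    "\<And>j. j < n \<Longrightarrow> s j \<in> points X"
proof -
  show s: "s \<in> topspace (XN n)"
    using assms unfolding tuples_def by (elim CollectE conjE)
  show "s j \<in> points X" if "j < n" for j
    using XN_coordinate[OF s that] .
  show "\<And>j k. k < n \<Longrightarrow> j \<le> k \<Longrightarrow> leX (s j) (s k)" "s ` {..<n} \<in> chains n"
    using assms unfolding tuples_def by blast+
qed

lemma tail_upset:
  assumes s: "s \<in> tuples n" and j: "j < n"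
  shows "upset_of leX (s ` {..<n}) (s ` {j..<n})"
  unfolding upset_of_def
proof (intro conjI ballI impI)
  note s' = tuplesD[OF s]
  show "s ` {j..<n} \<subseteq> s ` {..<n}" by auto
  fix x y assume "x \<in> s ` {j..<n}" "y \<in> s ` {..<n}" and le: "leX x y"
  then obtain k l where kl: "x = s k" "y = s l" "j \<le> k" "k < n" "l < n" by auto
  show "y \<in> s ` {j..<n}"
  proof (cases "j \<le> l")
    \<comment> \<open>An entry before the cut that lies above an entry of the tail is equal to it,
      so it occurs in the tail too.\<close>
    case False
    then have "leX y x"
      using s'(2)[of k l] kl by simp
    then have "y = x"
      using leX_antisym le s'(4) kl by auto
    then show ?thesis
      using kl by auto
  qed (use kl in auto)
qed

lemma tail_in_chains:
  assumes "s \<in> tuples n" "j < n"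
  shows "s ` {j..<n} \<in> chains n"
  using upset_in_chains[OF tuplesD(3)[OF assms(1)] tail_upset[OF assms]] assms(2) by auto

text \<open>A box constrains all of the finitely many entries of the tail, a diamond at least one of
  them.\<close>

lemma continuous_tail:
  assumes "j < n"
  shows "continuous_map (TN n) (otop (T n)) (\<lambda>s. s ` {j..<n})"
proof (rule continuous_map_T)
  show "(\<lambda>s. s ` {j..<n}) \<in> topspace (TN n) \<rightarrow> chains n"
    unfolding topspace_TN using tail_in_chains assms by auto
  fix V assume V: "clopen_in X V"
  have op: "openin (TN n) {s \<in> tuples n. s k \<in> V}" if "k < n" for k
  proof -
    have "{s \<in> tuples n. s k \<in> V} = tuples n \<inter> {s \<in> topspace (XN n). s k \<in> V}"
      using tuplesD(1) by blast
    then show ?thesis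
      using clopen_coordinate(1)[OF that V] by (simp only: openin_subtopology_Int2)
  qed
  have "{s \<in> tuples n. s ` {j..<n} \<subseteq> V} = (\<Inter>k\<in>{j..<n}. {s \<in> tuples n. s k \<in> V})"
    using assms by auto
  then show "openin (TN n) {s \<in> topspace (TN n). s ` {j..<n} \<subseteq> V}"
    unfolding topspace_TN using op assms by (simp only:) (intro openin_INT2; simp)
  have "{s \<in> tuples n. s ` {j..<n} \<inter> V \<noteq> {}} = (\<Union>k\<in>{j..<n}. {s \<in> tuples n. s k \<in> V})"
    by auto
  then show "openin (TN n) {s \<in> topspace (TN n). s ` {j..<n} \<inter> V \<noteq> {}}"
    unfolding topspace_TN using op by (simp only:) (intro openin_Union; auto)
qed

lemma image_tuples: "(\<lambda>s. s ` {..<n}) ` tuples n = chains n"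
proof (intro subset_antisym subsetI)
  fix C assume C: "C \<in> chains n"
  note C' = chainsD[OF C]
  obtain s where s: "s ` {..<n} = C" "\<And>j k. k < n \<Longrightarrow> j \<le> k \<Longrightarrow> leX (s j) (s k)"
    using finite_chain_enumeration[OF C'(2,1,3,5)] by metis
  define t where "t = restrict s {..<n}"
  have "t ` {..<n} = C"
    using s(1) by (auto simp: t_def)
  moreover have "t \<in> topspace (XN n)"
    using s(1) C'(4) by (auto simp: t_def)
  moreover have "leX (t j) (t k)" if "k < n" "j \<le> k" for j k
    using s(2)[OF that] that by (simp add: t_def)
  ultimately have "t \<in> tuples n"
    using C unfolding tuples_def by blast
  then show "C \<in> (\<lambda>s. s ` {..<n}) ` tuples n"
    using \<open>t ` {..<n} = C\<close> by blast
qed (use tuplesD(3) in blast)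

text \<open>A continuous map from a compact space onto a Hausdorff space is a quotient map. For
  \<open>n = 0\<close> both spaces are empty, since chains are nonempty.\<close>

lemma quotient_tuples: "quotient_map (TN n) (otop (T n)) (\<lambda>s. s ` {..<n})"
proof (cases "n = 0")
  case True
  then have "chains n = {}"
    by (auto simp: chains_def)
  then show ?thesis
    using image_tuples[of n] unfolding quotient_map_def topspace_TN points_T by auto
next
  case False
  then have "continuous_map (TN n) (otop (T n)) (\<lambda>s. s ` {..<n})"
    using continuous_tail[of 0 n] by (simp add: lessThan_atLeast0)
  then show ?thesis
    using continuous_imp_quotient_map compact_TN Hausdorff_T image_tuples points_T topspace_TN by metis
qed

lemma compact_T: "compact_space (otop (T n))"
  using image_compactin[OF compact_TN[unfolded compact_space_def] quotient_imp_continuous_map[OF quotient_tuples]]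
  unfolding compact_space_def topspace_TN image_tuples points_T .

text \<open>A quotient map reflects openness and closedness, so it suffices to look at tuples. There
  the downset of \<open>V\<close> becomes the union, over the finitely many \<open>j < n\<close>, of
  the preimages of \<open>V\<close> under the continuous map taking a tuple to its tail from
  \<open>j\<close>.\<close>

lemma clopen_down_T:
  assumes V: "clopen_in (T n) V"
  shows "clopen_in (T n) {C \<in> points (T n). \<exists>D\<in>V. ole (T n) C D}" (is "clopen_in _ ?D")
proof -
  have Vc: "V \<subseteq> chains n"
    using V closedin_subset points_T unfolding clopen_in_def by metis
  have "(\<exists>D\<in>V. upset_of leX (s ` {..<n}) D) \<longleftrightarrow> (\<exists>j\<in>{..<n}. s ` {j..<n} \<in> V)" if s: "s \<in> tuples n" for s
  proof
    note s' = tuplesD[OF s]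
    assume "\<exists>D\<in>V. upset_of leX (s ` {..<n}) D"
    then obtain D where D: "D \<in> V" "upset_of leX (s ` {..<n}) D" by blast
    then have sub: "D \<subseteq> s ` {..<n}" and up: "\<And>x y. x \<in> D \<Longrightarrow> y \<in> s ` {..<n} \<Longrightarrow> leX x y \<Longrightarrow> y \<in> D"
      unfolding upset_of_def by auto
    have "D \<noteq> {}"
      using D(1) Vc chainsD(1) by blast
    then obtain k where k: "k < n" "s k \<in> D"
      using sub by auto
    \<comment> \<open>The first index hitting \<open>D\<close> is the right cut: no earlier entry is
      in \<open>D\<close>, and upward closure puts all later entries into \<open>D\<close>.\<close>
    define j where "j = (LEAST k. k < n \<and> s k \<in> D)"
    have j: "j < n" "s j \<in> D"
      using LeastI[of "\<lambda>k. k < n \<and> s k \<in> D" k] k by (auto simp: j_def)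
    have "D = s ` {j..<n}"
    proof (intro subset_antisym subsetI)
      fix y assume y: "y \<in> D"
      then obtain l where l: "y = s l" "l < n"
        using sub by auto
      then have "j \<le> l"
        unfolding j_def using y by (intro Least_le) simp
      then show "y \<in> s ` {j..<n}"
        using l by auto
    next
      fix y assume "y \<in> s ` {j..<n}"
      then obtain l where l: "y = s l" "j \<le> l" "l < n" by auto
      then show "y \<in> D"
        using up[OF j(2), of y] s'(2)[of l j] by auto
    qed
    then show "\<exists>j\<in>{..<n}. s ` {j..<n} \<in> V"
      using D(1) j(1) by auto
  next
    assume "\<exists>j\<in>{..<n}. s ` {j..<n} \<in> V"
    then show "\<exists>D\<in>V. upset_of leX (s ` {..<n}) D"
      using tail_upset[OF s] by auto
  qed
  then have eq: "{s \<in> topspace (TN n). s ` {..<n} \<in> ?D} = (\<Union>j\<in>{..<n}. {s \<in> topspace (TN n). s ` {j..<n} \<in> V})"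
    using tuplesD(3) unfolding topspace_TN points_T ole_T by blast
  have 1: "openin (TN n) {s \<in> topspace (TN n). s ` {j..<n} \<in> V} \<and> closedin (TN n) {s \<in> topspace (TN n). s ` {j..<n} \<in> V}"
    if "j < n" for j
    using openin_continuous_map_preimage[OF continuous_tail[OF that]] closedin_continuous_map_preimage[OF continuous_tail[OF that]] V
    unfolding clopen_in_def by blast
  have "openin (TN n) {s \<in> topspace (TN n). s ` {..<n} \<in> ?D}"
    unfolding eq using 1 by (intro openin_Union) auto
  moreover have "closedin (TN n) {s \<in> topspace (TN n). s ` {..<n} \<in> ?D}"
    unfolding eq using 1 by (intro closedin_Union) auto
  moreover have "?D \<subseteq> points (T n)" by auto
  ultimately show ?thesis
    using quotient_tuples[of n, unfolded quotient_map_def, THEN conjunct2, rule_format, of ?D]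
      quotient_tuples[of n, unfolded quotient_map_closedin, THEN conjunct2, rule_format, of ?D]
    unfolding clopen_in_def by (simp only: simp_thms)
qed

lemma esakia_T: "esakia_order (T n)"
proof
  show "ole (T n) C C" for C
    unfolding ole_T by (simp add: upset_of_def)
  show "ole (T n) C E" if "ole (T n) C D" "ole (T n) D E" "C \<in> points (T n)" "D \<in> points (T n)" "E \<in> points (T n)" for C D E
    using that unfolding ole_T upset_of_def by blast
qed (rule clopen_down_T)

end

section \<open>The coproduct\<close>

lemma (in heyting_algebra) prime_filter_eqI:
  assumes "a \<in> carrier H" "b \<in> carrier H" "\<And>P. prime_filter H P \<Longrightarrow> a \<in> P \<longleftrightarrow> b \<in> P"
  shows "a = b"
proof (rule le_antisym)
  show "a \<sqsubseteq> b"
    using prime_filter_separation[OF assms(1,2)] assms(3) by metis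
  show "b \<sqsubseteq> a"
    using prime_filter_separation[OF assms(2,1)] assms(3) by metis
qed (use assms in auto)

lemma (in esakia_order) point_prime_filter:
  assumes "x \<in> points Y"
  shows "prime_filter K {U \<in> carrier K. x \<in> U}"
  unfolding prime_filter_def
proof (intro conjI ballI impI)
  show "{U \<in> carrier K. x \<in> U} \<noteq> {}" "{U \<in> carrier K. x \<in> U} \<noteq> carrier K"
    using assms dual_algebra_closed(1,2) by blast+
qed (auto simp: dual_algebra_ops dual_algebra_closed)

lemma GA_heyting: "H \<in> GA n \<Longrightarrow> heyting_algebra H"
  by (simp add: GA_def goedel_algebra_def)

lemma mem_up_prime: "w \<in> up_prime H z \<longleftrightarrow> prime_filter H w \<and> z \<subseteq> w"
  by (simp add: up_prime_def)

context heyting_family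
begin

section \<open>The candidate algebra and its coprojections\<close>

abbreviation coproduct :: "nat \<Rightarrow> ('i \<Rightarrow> 'a set) set set heyting" where
  "coproduct n \<equiv> dual_algebra (T n)"

text \<open>The points above a chain are its tails, and these are nested, which gives prelinearity.
  For the depth equation, a chain outside \<open>x (Suc k)\<close> has only proper upsets above it
  in \<open>x (Suc k)\<close>; these have fewer points and lie in the previous level of
  \<open>bd\<close> by induction.\<close>

lemma GA_coproduct: "coproduct n \<in> GA n"
proof -
  interpret K: esakia_order "T n"
    by (rule esakia_T)
  have "goedel_algebra (coproduct n)"
  proof (rule K.goedel_dual_algebra)
    fix C D E assume C: "C \<in> points (T n)" "D \<in> points (T n)" "E \<in> points (T n)" "ole (T n) C D" "ole (T n) C E"
    obtain x where x: "x \<in> C" "D = up C x"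
      using chains_upsetE C unfolding points_T ole_T by metis
    obtain y where y: "y \<in> C" "E = up C y"
      using chains_upsetE C unfolding points_T ole_T by metis
    have "leX x y \<or> leX y x"
      using chainsD(5)[of C n] C(1) x y unfolding points_T by blast
    then show "ole (T n) D E \<or> ole (T n) E D"
    proof
      assume "leX x y"
      then have "upset_of leX D E"
        unfolding x y upset_of_def up_def using leX_trans by blast
      then show ?thesis by (simp add: ole_T)
    next
      assume "leX y x"
      then have "upset_of leX E D"
        unfolding x y upset_of_def up_def using leX_trans by blast
      then show ?thesis by (simp add: ole_T)
    qed
  qed
  \<comment> \<open>The level \<open>k\<close> is kept apart from the bound \<open>n\<close> of the
    space, so that the induction can descend while all chains stay in
    \<open>chains n\<close>.\<close>
  moreover have "C \<in> bd (coproduct n) x k"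
    if "x \<in> {1..k} \<rightarrow> carrier (coproduct n)" "C \<in> chains n" "card C \<le> k" for x k C
    using that
  proof (induction k arbitrary: C)
    case 0
    then show ?case
      using chainsD(1,2) by auto
  next
    case (Suc k)
    have x: "x \<in> {1..k} \<rightarrow> carrier (coproduct n)" "x (Suc k) \<in> carrier (coproduct n)"
      using Suc.prems(1) by (auto simp: Pi_def)
    have bd: "bd (coproduct n) x k \<in> carrier (coproduct n)"
      using bd_closed[OF K.heyting_algebra_axioms x(1)] .
    have eq: "bd (coproduct n) x (Suc k) = x (Suc k) \<union> (x (Suc k) \<Rrightarrow>\<^bsub>coproduct n\<^esub> bd (coproduct n) x k)"
      using K.dual_algebra_ops(3)[OF x(2) K.dual_algebra_imp_closed[OF x(2) bd]] by simp
    show ?case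
    proof (cases "C \<in> x (Suc k)")
      case False
      have "\<not> upset_of leX C D" if D: "D \<in> x (Suc k) - bd (coproduct n) x k" for D
      proof
        assume up: "upset_of leX C D"
        then have "D \<subset> C"
          using False D by (auto simp: upset_of_def)
        then have "card D \<le> k"
          using psubset_card_mono[OF chainsD(2)[OF Suc.prems(2)], of D] Suc.prems(3) by linarith
        moreover have "D \<in> chains n"
          using D K.carrier_subset[OF x(2)] unfolding points_T by auto
        ultimately show False
          using Suc.IH[OF x(1), of D] D by simp
      qed
      then show ?thesis
        unfolding eq K.dual_algebra_imp points_T ole_T using Suc.prems(2) by simp
    next
      case True
      then show ?thesis
        unfolding eq by simp
    qed
  qed
  then have "bd (coproduct n) x n = \<top>\<^bsub>coproduct n\<^esub>" if "x \<in> {1..n} \<rightarrow> carrier (coproduct n)" for x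
    unfolding K.dual_algebra_ops points_T
    using that chainsD(3) K.carrier_subset[OF bd_closed[OF K.heyting_algebra_axioms that]] points_T by blast
  ultimately show ?thesis
    by (simp add: GA_def)
qed

lemma coproduct_map_eq:
  assumes "i \<in> I"
  shows "coproduct_map n I G i a = {C \<in> chains n. \<forall>x\<in>C. a \<in> x i}"
  unfolding coproduct_map_def Let_def points_T chain_box_def
  using chains_closed_chain chainsD(4) assms by (fastforce simp: points_X stone_map_def)

text \<open>A coprojection tests only the least point of a chain, and \<open>x\<close> is the least
  point of \<open>up C x\<close>. Passing to tails therefore makes every point of a chain
  accessible.\<close>

lemma up_in_coproduct_map:
  assumes "i \<in> I" "a \<in> carrier (G i)" "C \<in> chains n" "x \<in> C"
  shows "up C x \<in> coproduct_map n I G i a \<longleftrightarrow> a \<in> x i"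
proof -
  have "(\<forall>y\<in>up C x. a \<in> y i) \<longleftrightarrow> a \<in> x i"
    using assms(1,4) by (auto simp: up_def leX_iff)
  then show ?thesis
    using coproduct_map_eq[OF assms(1)] up_in_chains[OF assms(3,4)] by simp
qed

text \<open>Joins are preserved because a chain is tested at its least point, where primality
  decides. Implication rests on the projections being upsets: the prime filters above some
  \<open>x i\<close> are again projections of points of \<open>C\<close>, and these points
  correspond to the tails over which implication in the dual algebra quantifies.\<close>

lemma coproduct_map_hom:
  assumes i: "i \<in> I"
  shows "coproduct_map n I G i \<in> heyting_hom (G i) (coproduct n)"
proof -
  interpret K: esakia_order "T n"
    by (rule esakia_T)
  interpret Gi: heyting_algebra "G i"
    by (rule heyting[OF i])
  define e where "e = coproduct_map n I G i"
  have e: "e a = {C \<in> chains n. \<forall>x\<in>C. a \<in> x i}" for a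
    unfolding e_def by (rule coproduct_map_eq[OF i])
  have pf: "prime_filter (G i) (x i)" if "C \<in> chains n" "x \<in> C" for C x
    using chainsD(4)[OF that(1)] that(2) i points_X by blast
  have carrier: "e a \<in> carrier (coproduct n)" if a: "a \<in> carrier (G i)" for a
  proof -
    have "{C \<in> points (T n). C \<subseteq> {x \<in> points X. a \<in> x i}} = e a"
      using chainsD(4) by (auto simp: e points_T)
    then have "clopen_in (T n) (e a)"
      using clopen_box(1)[OF clopen_eval[OF i a], of n] by simp
    moreover have "upset_of (ole (T n)) (points (T n)) (e a)"
      by (auto simp: upset_of_def e ole_T points_T)
    ultimately show ?thesis
      by (simp add: K.carrier_dual_algebra)
  qed
  have "e a \<inter> e b = e (a \<sqinter>\<^bsub>G i\<^esub> b)" if "a \<in> carrier (G i)" "b \<in> carrier (G i)" for a b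
    using Gi.prime_filterD(5)[OF pf that] by (auto simp: e)
  moreover have "e (a \<squnion>\<^bsub>G i\<^esub> b) = e a \<union> e b" if ab: "a \<in> carrier (G i)" "b \<in> carrier (G i)" for a b
  proof (intro subset_antisym subsetI)
    fix C assume "C \<in> e (a \<squnion>\<^bsub>G i\<^esub> b)"
    then have C: "C \<in> chains n" "\<forall>x\<in>C. (a \<squnion>\<^bsub>G i\<^esub> b) \<in> x i"
      by (auto simp: e)
    note C' = chainsD[OF C(1)]
    obtain m where m: "m \<in> C" "\<And>y. y \<in> C \<Longrightarrow> leX m y"
      using finite_chain_min[OF C'(2,1,5)] by metis
    have "a \<in> m i \<or> b \<in> m i"
      using C(2) m(1) Gi.prime_filterD(6)[OF pf[OF C(1) m(1)] ab] by simp
    moreover have "m i \<subseteq> y i" if "y \<in> C" for y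
      using m(2)[OF that] i by (simp add: leX_iff)
    ultimately show "C \<in> e a \<union> e b"
      using C(1) by (auto simp: e)
  next
    fix C assume "C \<in> e a \<union> e b"
    then show "C \<in> e (a \<squnion>\<^bsub>G i\<^esub> b)"
      using Gi.prime_filterD(6)[OF pf ab] by (auto simp: e)
  qed
  moreover have "e (a \<Rrightarrow>\<^bsub>G i\<^esub> b) = (e a \<Rrightarrow>\<^bsub>coproduct n\<^esub> e b)" if ab: "a \<in> carrier (G i)" "b \<in> carrier (G i)" for a b
  proof -
    have "C \<in> e (a \<Rrightarrow>\<^bsub>G i\<^esub> b) \<longleftrightarrow> C \<in> (e a \<Rrightarrow>\<^bsub>coproduct n\<^esub> e b)" if C: "C \<in> chains n" for C
    proof -
      have "C \<in> e (a \<Rrightarrow>\<^bsub>G i\<^esub> b) \<longleftrightarrow> (\<forall>x\<in>C. \<forall>Q. prime_filter (G i) Q \<longrightarrow> x i \<subseteq> Q \<longrightarrow> a \<in> Q \<longrightarrow> b \<in> Q)"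
        using C Gi.imp_in_prime_filter[OF pf[OF C] ab] by (simp add: e)
      also have "\<dots> \<longleftrightarrow> (\<forall>x\<in>C. a \<in> x i \<longrightarrow> b \<in> x i)"
      proof
        assume *: "\<forall>x\<in>C. \<forall>Q. prime_filter (G i) Q \<longrightarrow> x i \<subseteq> Q \<longrightarrow> a \<in> Q \<longrightarrow> b \<in> Q"
        show "\<forall>x\<in>C. a \<in> x i \<longrightarrow> b \<in> x i"
          using * pf[OF C] by (meson order_refl)
      next
        assume *: "\<forall>x\<in>C. a \<in> x i \<longrightarrow> b \<in> x i"
        show "\<forall>x\<in>C. \<forall>Q. prime_filter (G i) Q \<longrightarrow> x i \<subseteq> Q \<longrightarrow> a \<in> Q \<longrightarrow> b \<in> Q"
          using chainsD(6)[OF C i] * by metis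
      qed
      also have "\<dots> \<longleftrightarrow> (\<forall>x\<in>C. up C x \<in> e a \<longrightarrow> up C x \<in> e b)"
        using up_in_coproduct_map[OF i _ C] ab unfolding e_def by auto
      also have "\<dots> \<longleftrightarrow> C \<in> (e a \<Rrightarrow>\<^bsub>coproduct n\<^esub> e b)"
      proof
        assume *: "\<forall>x\<in>C. up C x \<in> e a \<longrightarrow> up C x \<in> e b"
        have "\<not> upset_of leX C D" if "D \<in> e a - e b" for D
        proof
          assume up: "upset_of leX C D"
          have "D \<in> chains n"
            using that by (auto simp: e)
          then show False
            using chains_upsetE[OF C _ up] * that by blast
        qed
        then show "C \<in> (e a \<Rrightarrow>\<^bsub>coproduct n\<^esub> e b)"
          unfolding K.dual_algebra_imp points_T ole_T using C by simp
      next
        assume *: "C \<in> (e a \<Rrightarrow>\<^bsub>coproduct n\<^esub> e b)"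
        then have "\<forall>D\<in>e a - e b. \<not> upset_of leX C D"
          unfolding K.dual_algebra_imp ole_T by simp
        then show "\<forall>x\<in>C. up C x \<in> e a \<longrightarrow> up C x \<in> e b"
          using up_upset by blast
      qed
      finally show ?thesis .
    qed
    moreover have "e (a \<Rrightarrow>\<^bsub>G i\<^esub> b) \<subseteq> chains n" "(e a \<Rrightarrow>\<^bsub>coproduct n\<^esub> e b) \<subseteq> chains n"
      unfolding K.dual_algebra_imp points_T by (auto simp: e)
    ultimately show ?thesis by blast
  qed
  moreover have "e \<bottom>\<^bsub>G i\<^esub> = {}"
    using Gi.prime_filterD(3)[OF pf] chainsD(1) by (fastforce simp: e)
  moreover have "e \<top>\<^bsub>G i\<^esub> = points (T n)"
    using Gi.prime_filterD(2)[OF pf] by (auto simp: e points_T)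
  ultimately have "e \<in> heyting_hom (G i) (coproduct n)"
    unfolding heyting_hom_def using carrier by (auto simp: K.dual_algebra_ops)
  then show ?thesis
    by (simp add: e_def)
qed

subsection \<open>Uniqueness\<close>

text \<open>For homomorphisms \<open>f i\<close> this is the induced map from the dual of their
  target into \<open>X\<close>. In the uniqueness argument \<open>f i\<close> is the composite of
  \<open>h\<close> with a coprojection, so the map depends on these composites alone.\<close>

definition point_of :: "('i \<Rightarrow> 'a \<Rightarrow> 'c) \<Rightarrow> 'c set \<Rightarrow> 'i \<Rightarrow> 'a set" where
  "point_of f w = (\<lambda>i\<in>I. filter_preimage (G i) (f i) w)"

text \<open>By compactness the preimage of \<open>z\<close> under \<open>h\<close> is given by a
  chain \<open>C\<close>, and \<open>C\<close> is reconstructed here from the composites with the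
  coprojections. Each \<open>w\<close> above \<open>z\<close> contributes the least point of its own
  chain, and lifting realises every tail of \<open>C\<close> by some such \<open>w\<close>.\<close>

lemma chain_of_prime_filter:
  assumes H: "heyting_algebra H" and h: "h \<in> heyting_hom (coproduct n) H" and z: "prime_filter H z"
  shows "filter_preimage (coproduct n) h z =
    {U \<in> carrier (coproduct n). point_of (\<lambda>i a. h (coproduct_map n I G i a)) ` up_prime H z \<in> U}"
proof -
  let ?K = "coproduct n"
  let ?g = "point_of (\<lambda>i a. h (coproduct_map n I G i a))"
  interpret K: esakia_order "T n"
    by (rule esakia_T)
  have Kh: "heyting_algebra ?K"
    by (rule K.heyting_algebra_axioms)
  have point: "\<exists>C. C \<in> chains n \<and> filter_preimage ?K h w = {U \<in> carrier ?K. C \<in> U}" if "prime_filter H w" for w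
    by (rule K.prime_filter_dual_algebra[OF compact_T prime_filter_preimage[OF Kh H h that]])
      (auto simp: points_T)
  \<comment> \<open>At a single \<open>w\<close> the composites reveal just the least point of its
    chain.\<close>
  have least: "?g w = m"
    if w: "filter_preimage ?K h w = {U \<in> carrier ?K. D \<in> U}" and D: "D \<in> chains n"
      and m: "m \<in> D" "\<And>y. y \<in> D \<Longrightarrow> leX m y" for w D m
  proof (rule extensionalityI[of _ I])
    show "?g w \<in> extensional I"
      by (simp add: point_of_def)
    show "m \<in> extensional I"
      using chainsD(4)[OF D] m(1) points_X by blast
    fix i assume i: "i \<in> I"
    have "h (coproduct_map n I G i a) \<in> w \<longleftrightarrow> a \<in> m i" if a: "a \<in> carrier (G i)" for a
    proof -
      have "coproduct_map n I G i a \<in> carrier ?K"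
        using heyting_homD(1)[OF coproduct_map_hom[OF i] a] .
      then have "h (coproduct_map n I G i a) \<in> w \<longleftrightarrow> D \<in> coproduct_map n I G i a"
        using w by (auto simp: filter_preimage_def)
      also have "\<dots> \<longleftrightarrow> a \<in> m i"
      proof -
        have "up D m = D"
          using m(2) by (auto simp: up_def)
        then show ?thesis
          using up_in_coproduct_map[OF i a D m(1)] by simp
      qed
      finally show ?thesis .
    qed
    moreover have "m i \<subseteq> carrier (G i)"
      using heyting_algebra.prime_filterD(1)[OF heyting[OF i]] chainsD(4)[OF D] m(1) i points_X by blast
    ultimately show "?g w i = m i"
      using i by (auto simp: point_of_def filter_preimage_def)
  qed
  obtain C where C: "C \<in> chains n" "filter_preimage ?K h z = {U \<in> carrier ?K. C \<in> U}"
    using point[OF z] by blast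
  have "?g ` up_prime H z = C"
  proof (intro subset_antisym subsetI)
    fix x assume "x \<in> ?g ` up_prime H z"
    then obtain w where w: "prime_filter H w" "z \<subseteq> w" "x = ?g w"
      by (auto simp: mem_up_prime)
    obtain D where D: "D \<in> chains n" "filter_preimage ?K h w = {U \<in> carrier ?K. D \<in> U}"
      using point[OF w(1)] by blast
    obtain m where m: "m \<in> D" "\<And>y. y \<in> D \<Longrightarrow> leX m y"
      using finite_chain_min[OF chainsD(2,1,5)[OF D(1)]] by metis
    have x: "x = m"
      using least[OF D(2,1) m] w(3) by simp
    show "x \<in> C"
    proof (rule ccontr)
      assume "x \<notin> C"
      \<comment> \<open>A clopen \<open>V\<close> around \<open>m\<close> that misses
        \<open>C\<close> gives the clopen upset of all chains avoiding \<open>V\<close>. It contains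
        \<open>C\<close>, hence it would have to contain \<open>D\<close>, although \<open>m\<close>
        is in \<open>D\<close>.\<close>
      then obtain V where V: "clopen_in X V" "m \<in> V" "V \<inter> C = {}"
        using clopen_separation[of m C] chainsD(2,4)[OF C(1)] chainsD(4)[OF D(1)] m(1) x by blast
      have V': "clopen_in X (points X - V)"
        using V(1) by (auto simp: clopen_in_def)
      let ?U = "{E \<in> points (T n). E \<subseteq> points X - V}"
      have "upset_of (ole (T n)) (points (T n)) ?U"
        by (auto simp: upset_of_def ole_T)
      then have U: "?U \<in> carrier ?K"
        using clopen_box(1)[OF V'] by (simp add: K.carrier_dual_algebra)
      have "C \<in> ?U"
        using C(1) V(3) chainsD(4)[OF C(1)] by (auto simp: points_T)
      with U have "?U \<in> filter_preimage ?K h z"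
        unfolding C(2) by blast
      then have "?U \<in> filter_preimage ?K h w"
        using w(2) unfolding filter_preimage_def by blast
      then have "D \<in> ?U"
        unfolding D(2) by blast
      then show False
        using m(1) V(2) by auto
    qed
  next
    fix x assume x: "x \<in> C"
    \<comment> \<open>The tail \<open>up C x\<close> is a point above \<open>C\<close>; its prime
      filter lifts to some \<open>w\<close> above \<open>z\<close>, and \<open>x\<close> is the
      least point of the chain of \<open>w\<close>.\<close>
    let ?Q = "{U \<in> carrier ?K. up C x \<in> U}"
    have up: "up C x \<in> chains n"
      using up_in_chains[OF C(1) x] .
    then have Q: "prime_filter ?K ?Q"
      using K.point_prime_filter points_T by blast
    have "up C x \<in> U" if "U \<in> carrier ?K" "C \<in> U" for U
      using that up up_upset unfolding K.carrier_dual_algebra upset_of_def[of "ole (T n)"] ole_T points_T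
      by simp
    then have sub: "filter_preimage ?K h z \<subseteq> ?Q"
      unfolding C(2) by (intro Collect_mono impI conjI) auto
    obtain w where w: "prime_filter H w" "z \<subseteq> w" "filter_preimage ?K h w = ?Q"
      by (rule prime_filter_lifting[OF Kh H h z Q sub])
    have "?g w = x"
      using least[OF w(3) up] x by (auto simp: up_def)
    then show "x \<in> ?g ` up_prime H z"
      using w by (auto simp: mem_up_prime)
  qed
  then show ?thesis
    using C(2) by simp
qed

lemma coproduct_hom_unique:
  assumes H: "heyting_algebra H" and h: "h \<in> heyting_hom (coproduct n) H" "h' \<in> heyting_hom (coproduct n) H"
    and eq: "\<And>i a. i \<in> I \<Longrightarrow> a \<in> carrier (G i) \<Longrightarrow> h (coproduct_map n I G i a) = h' (coproduct_map n I G i a)"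
    and U: "U \<in> carrier (coproduct n)"
  shows "h U = h' U"
proof (rule heyting_algebra.prime_filter_eqI[OF H])
  show "h U \<in> carrier H" "h' U \<in> carrier H"
    using heyting_homD(1)[OF h(1) U] heyting_homD(1)[OF h(2) U] by auto
  fix z assume z: "prime_filter H z"
  have "point_of (\<lambda>i a. h (coproduct_map n I G i a)) w = point_of (\<lambda>i a. h' (coproduct_map n I G i a)) w" for w
    unfolding point_of_def filter_preimage_def
    by (intro restrict_ext Collect_cong) (simp add: eq cong: conj_cong)
  then have "filter_preimage (coproduct n) h z = filter_preimage (coproduct n) h' z"
    using chain_of_prime_filter[OF H h(1) z] chain_of_prime_filter[OF H h(2) z] by simp
  then show "h U \<in> z \<longleftrightarrow> h' U \<in> z"
    using U by (auto simp: filter_preimage_def)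
qed

subsection \<open>Existence\<close>

lemma continuous_point_of:
  assumes H: "heyting_algebra H" and f: "\<And>i. i \<in> I \<Longrightarrow> f i \<in> heyting_hom (G i) H"
  shows "continuous_map (otop (dual_space H)) (otop X) (point_of f)"
  unfolding otop_X continuous_map_componentwise
proof (intro conjI ballI)
  show "point_of f ` points (dual_space H) \<subseteq> extensional I"
    by (auto simp: point_of_def)
  fix i assume i: "i \<in> I"
  interpret H: heyting_algebra H by fact
  interpret Gi: heyting_algebra "G i"
    by (rule heyting[OF i])
  have pre: "prime_filter (G i) (point_of f w i)" if "prime_filter H w" for w
    using prime_filter_preimage[OF heyting[OF i] H f[OF i] that] i by (simp add: point_of_def)
  have mem: "a \<in> point_of f w i \<longleftrightarrow> f i a \<in> w" if "a \<in> carrier (G i)" for a w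
    using that i by (simp add: point_of_def filter_preimage_def)
  show "continuous_map (otop (dual_space H)) (otop (dual_space (G i))) (\<lambda>w. point_of f w i)"
    unfolding dual_space_def[of "G i"] ordered_space.simps
  proof (rule continuous_on_generated_topo)
    fix U assume "U \<in> {stone_map (G i) a |a. a \<in> carrier (G i)} \<union> {{P. prime_filter (G i) P} - stone_map (G i) a |a. a \<in> carrier (G i)}"
    then consider a where "a \<in> carrier (G i)" "U = stone_map (G i) a"
      | a where "a \<in> carrier (G i)" "U = {P. prime_filter (G i) P \<and> a \<notin> P}"
      unfolding Gi.stone_map_compl by blast
    then show "openin (otop (dual_space H)) ((\<lambda>w. point_of f w i) -` U \<inter> points (dual_space H))"
    proof cases
      case 1
      then have "(\<lambda>w. point_of f w i) -` U \<inter> points (dual_space H) = stone_map H (f i a)"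
        using pre mem by (auto simp: H.points_dual_space stone_map_def)
      then show ?thesis
        using H.openin_stone_map(1)[OF heyting_homD(1)[OF f[OF i] 1(1)]] by simp
    next
      case 2
      then have "(\<lambda>w. point_of f w i) -` U \<inter> points (dual_space H) = {P. prime_filter H P \<and> f i a \<notin> P}"
        using pre mem by (auto simp: H.points_dual_space)
      then show ?thesis
        using H.openin_stone_map(2)[OF heyting_homD(1)[OF f[OF i] 2(1)]] by simp
    qed
  next
    have "stone_map (G i) \<top>\<^bsub>G i\<^esub> = {P. prime_filter (G i) P}"
      using Gi.prime_filterD(2) by (auto simp: stone_map_def)
    then show "(\<lambda>w. point_of f w i) ` points (dual_space H) \<subseteq>
      \<Union>({stone_map (G i) a |a. a \<in> carrier (G i)} \<union> {{P. prime_filter (G i) P} - stone_map (G i) a |a. a \<in> carrier (G i)})"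
      using pre Gi.top_closed unfolding H.points_dual_space by blast
  qed
qed

text \<open>The value \<open>h U\<close> is the element of \<open>H\<close> whose Stone set is the
  clopen upset of all \<open>z\<close> with \<open>\<phi> z\<close> in \<open>U\<close>. Every law
  for \<open>h\<close> is then checked prime filter by prime filter.\<close>

lemma coproduct_hom_exists:
  fixes H :: "'c heyting"
  assumes H: "H \<in> GA n" and f: "\<And>i. i \<in> I \<Longrightarrow> f i \<in> heyting_hom (G i) H"
  obtains h where "h \<in> heyting_hom (coproduct n) H"
    "\<And>i a. i \<in> I \<Longrightarrow> a \<in> carrier (G i) \<Longrightarrow> h (coproduct_map n I G i a) = f i a"
proof -
  have Hg: "goedel_algebra H"
    using H by (simp add: GA_def)
  interpret H: heyting_algebra H
    using GA_heyting[OF H] .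
  interpret K: esakia_order "T n"
    by (rule esakia_T)
  define g where "g = point_of f"
  define \<phi> where "\<phi> z = g ` up_prime H z" for z
  have g_mem: "a \<in> g w i \<longleftrightarrow> f i a \<in> w" if "i \<in> I" "a \<in> carrier (G i)" for a w i
    using that by (simp add: g_def point_of_def filter_preimage_def)
  have g_cont: "continuous_map (otop (dual_space H)) (otop X) g"
    unfolding g_def by (rule continuous_point_of[OF H.heyting_algebra_axioms f])
  have g_points: "g w \<in> points X" if "prime_filter H w" for w
    using g_cont that unfolding continuous_map_def H.points_dual_space by blast
  have g_mono: "leX (g w) (g v)" if "w \<subseteq> v" for w v
    using that by (auto simp: leX_iff g_def point_of_def filter_preimage_def)
  \<comment> \<open>The depth bound of \<open>H\<close> limits \<open>\<phi> z\<close> to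
    \<open>n\<close> points, prelinearity makes it a chain, and lifting along \<open>f i\<close>
    makes its projections upsets.\<close>
  have \<phi>_chains: "\<phi> z \<in> chains n" if z: "prime_filter H z" for z
    unfolding chains_def
  proof (intro CollectI conjI ballI allI impI)
    show "\<phi> z \<noteq> {}" "finite (\<phi> z)" "\<phi> z \<subseteq> points X"
      using z GA_up_prime_finite(1)[OF H z] g_points by (auto simp: \<phi>_def mem_up_prime)
    show "card (\<phi> z) \<le> n"
      using card_image_le[OF GA_up_prime_finite(1)[OF H z], of g] GA_up_prime_finite(2)[OF H z]
      by (simp add: \<phi>_def)
    show "leX x y \<or> leX y x" if xy: "x \<in> \<phi> z" "y \<in> \<phi> z" for x y
    proof -
      obtain w v where wv: "w \<in> up_prime H z" "x = g w" "v \<in> up_prime H z" "y = g v"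
        using xy by (auto simp: \<phi>_def)
      then show ?thesis
        using goedel_up_prime_chain[OF Hg z wv(1,3)] g_mono[of w v] g_mono[of v w] by auto
    qed
    fix i x Q assume i: "i \<in> I" and x: "x \<in> \<phi> z" and Q: "prime_filter (G i) Q" "x i \<subseteq> Q"
    obtain w where w: "prime_filter H w" "z \<subseteq> w" "x = g w"
      using x by (auto simp: \<phi>_def mem_up_prime)
    have "filter_preimage (G i) (f i) w \<subseteq> Q"
      using Q(2) i by (simp add: w(3) g_def point_of_def)
    then obtain v where v: "prime_filter H v" "w \<subseteq> v" "filter_preimage (G i) (f i) v = Q"
      using prime_filter_lifting[OF heyting[OF i] H.heyting_algebra_axioms f[OF i] w(1) Q(1)] by metis
    have "g v \<in> \<phi> z"
      using v(1,2) w(2) by (auto simp: \<phi>_def mem_up_prime)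
    moreover have "g v i = Q"
      using v(3) i by (simp add: g_def point_of_def)
    ultimately show "\<exists>y\<in>\<phi> z. y i = Q"
      by blast
  qed
  have \<phi>_upset: "upset_of leX (\<phi> z) (\<phi> w)" if z: "prime_filter H z" and w: "prime_filter H w" "z \<subseteq> w" for z w
    unfolding upset_of_def
  proof (intro conjI ballI impI)
    show "\<phi> w \<subseteq> \<phi> z"
      using w by (auto simp: \<phi>_def mem_up_prime)
    fix x y assume x: "x \<in> \<phi> w" and y: "y \<in> \<phi> z" and le: "leX x y"
    obtain v where v: "prime_filter H v" "w \<subseteq> v" "x = g v"
      using x by (auto simp: \<phi>_def mem_up_prime)
    obtain u where u: "prime_filter H u" "z \<subseteq> u" "y = g u"
      using y by (auto simp: \<phi>_def mem_up_prime)
    have "v \<subseteq> u \<or> u \<subseteq> v"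
      using goedel_up_prime_chain[OF Hg z, of v u] v u w(2) by (auto simp: mem_up_prime)
    then show "y \<in> \<phi> w"
    proof
      assume "v \<subseteq> u"
      then show ?thesis
        using u v(2) by (auto simp: \<phi>_def mem_up_prime)
    next
      \<comment> \<open>Distinct prime filters may have the same image under \<open>g\<close>;
        antisymmetry shows that this happens here.\<close>
      assume "u \<subseteq> v"
      then have "y = x"
        using leX_antisym[of y x] le g_mono[of u v] g_points u(1,3) v(1,3) by simp
      then show ?thesis
        using x by simp
    qed
  qed
  \<comment> \<open>Back condition: a point above \<open>\<phi> z\<close> is a tail starting at some
    \<open>g w\<close>, and this tail is \<open>\<phi> w\<close>.\<close>
  have \<phi>_back: "\<exists>w. prime_filter H w \<and> z \<subseteq> w \<and> D = \<phi> w"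
    if z: "prime_filter H z" and D: "D \<in> chains n" "upset_of leX (\<phi> z) D" for z D
  proof -
    obtain x where x: "x \<in> \<phi> z" "D = up (\<phi> z) x"
      using chains_upsetE[OF \<phi>_chains[OF z] D] .
    obtain w where w: "prime_filter H w" "z \<subseteq> w" "x = g w"
      using x(1) by (auto simp: \<phi>_def mem_up_prime)
    have gw: "g w \<in> \<phi> w"
      using w(1) by (auto simp: \<phi>_def mem_up_prime)
    have "D = \<phi> w"
    proof (intro subset_antisym subsetI)
      fix y assume "y \<in> D"
      then show "y \<in> \<phi> w"
        using \<phi>_upset[OF z w(1,2)] gw unfolding x(2) w(3) up_def upset_of_def by blast
    next
      fix y assume y: "y \<in> \<phi> w"
      then have "y \<in> \<phi> z"
        using \<phi>_upset[OF z w(1,2)] unfolding upset_of_def by blast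
      moreover have "leX (g w) y"
        using y g_mono by (auto simp: \<phi>_def mem_up_prime)
      ultimately show "y \<in> D"
        by (simp add: x(2) w(3) up_def)
    qed
    then show ?thesis
      using w by blast
  qed
  have \<phi>_cont: "continuous_map (otop (dual_space H)) (otop (T n)) \<phi>"
  proof (rule continuous_map_T)
    show "\<phi> \<in> points (dual_space H) \<rightarrow> chains n"
      using \<phi>_chains by (simp add: H.points_dual_space)
    \<comment> \<open>\<open>\<phi> z\<close> meets \<open>V\<close> exactly when \<open>z\<close>
      lies below some \<open>w\<close> with \<open>g w\<close> in \<open>V\<close>, so this rests on
      downsets of clopen sets being clopen in the dual of \<open>H\<close>.\<close>
    have dia: "clopen_in (dual_space H) {z \<in> points (dual_space H). \<phi> z \<inter> V \<noteq> {}}" if V: "clopen_in X V" for V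
    proof -
      have "clopen_in (dual_space H) {w \<in> points (dual_space H). g w \<in> V}"
        using openin_continuous_map_preimage[OF g_cont] closedin_continuous_map_preimage[OF g_cont] V
        unfolding clopen_in_def by blast
      from H.clopen_downset[OF this]
      have "clopen_in (dual_space H) {P. prime_filter H P \<and> (\<exists>Q\<in>{w \<in> points (dual_space H). g w \<in> V}. P \<subseteq> Q)}" .
      moreover have "{P. prime_filter H P \<and> (\<exists>Q\<in>{w \<in> points (dual_space H). g w \<in> V}. P \<subseteq> Q)}
          = {z \<in> points (dual_space H). \<phi> z \<inter> V \<noteq> {}}"
        unfolding H.points_dual_space \<phi>_def up_prime_def by blast
      ultimately show ?thesis by simp
    qed
    fix V assume V: "clopen_in X V"
    show "openin (otop (dual_space H)) {z \<in> points (dual_space H). \<phi> z \<inter> V \<noteq> {}}"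
      using dia[OF V] by (simp add: clopen_in_def)
    have V': "clopen_in X (points X - V)"
      using V by (auto simp: clopen_in_def)
    have "{z \<in> points (dual_space H). \<phi> z \<subseteq> V} = {z \<in> points (dual_space H). \<not> \<phi> z \<inter> (points X - V) \<noteq> {}}"
      using \<phi>_chains chainsD(4) unfolding H.points_dual_space by blast
    then show "openin (otop (dual_space H)) {z \<in> points (dual_space H). \<phi> z \<subseteq> V}"
      using clopen_in_compl[OF dia[OF V']] by (simp add: clopen_in_def)
  qed
  have "\<exists>a\<in>carrier H. \<forall>z. prime_filter H z \<longrightarrow> (a \<in> z \<longleftrightarrow> \<phi> z \<in> U)" if U: "U \<in> carrier (coproduct n)" for U
  proof -
    let ?W = "{z \<in> points (dual_space H). \<phi> z \<in> U}"
    have U': "clopen_in (T n) U" "upset_of (ole (T n)) (points (T n)) U"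
      using U by (simp_all add: K.carrier_dual_algebra)
    have "clopen_in (dual_space H) ?W"
      using openin_continuous_map_preimage[OF \<phi>_cont] closedin_continuous_map_preimage[OF \<phi>_cont] U'(1)
      unfolding clopen_in_def by blast
    moreover have "upset_of (\<subseteq>) (points (dual_space H)) ?W"
      unfolding upset_of_def
    proof (intro conjI ballI impI)
      fix z w assume z: "z \<in> ?W" and w: "w \<in> points (dual_space H)" "z \<subseteq> w"
      then have "ole (T n) (\<phi> z) (\<phi> w)" "\<phi> w \<in> points (T n)" "\<phi> z \<in> U"
        using \<phi>_upset \<phi>_chains by (auto simp: ole_T points_T H.points_dual_space)
      then show "w \<in> ?W"
        using U'(2) w(1) unfolding upset_of_def by simp
    qed auto
    ultimately obtain a where "a \<in> carrier H" "?W = stone_map H a"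
      by (rule H.clopen_upset_is_stone_map)
    then show ?thesis
      unfolding stone_map_def H.points_dual_space by (intro bexI[of _ a]) blast+
  qed
  \<comment> \<open>On the carrier the choice is forced, as an element of \<open>H\<close> is
    determined by the prime filters containing it.\<close>
  then obtain h where h: "\<And>U. U \<in> carrier (coproduct n) \<Longrightarrow> h U \<in> carrier H"
    "\<And>U z. U \<in> carrier (coproduct n) \<Longrightarrow> prime_filter H z \<Longrightarrow> h U \<in> z \<longleftrightarrow> \<phi> z \<in> U"
    by metis
  have imp: "h (U \<Rrightarrow>\<^bsub>coproduct n\<^esub> V) = (h U \<Rrightarrow>\<^bsub>H\<^esub> h V)"
    if UV: "U \<in> carrier (coproduct n)" "V \<in> carrier (coproduct n)" for U V
  proof (rule H.prime_filter_eqI)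
    show "h (U \<Rrightarrow>\<^bsub>coproduct n\<^esub> V) \<in> carrier H" "(h U \<Rrightarrow>\<^bsub>H\<^esub> h V) \<in> carrier H"
      using h(1) UV K.dual_algebra_imp_closed H.imp_closed by auto
    fix z assume z: "prime_filter H z"
    have "h (U \<Rrightarrow>\<^bsub>coproduct n\<^esub> V) \<in> z \<longleftrightarrow> \<phi> z \<in> (U \<Rrightarrow>\<^bsub>coproduct n\<^esub> V)"
      using h(2)[OF K.dual_algebra_imp_closed[OF UV] z] .
    also have "\<dots> \<longleftrightarrow> (\<forall>D\<in>U - V. \<not> upset_of leX (\<phi> z) D)"
      unfolding K.dual_algebra_imp points_T ole_T using \<phi>_chains[OF z] by simp
    \<comment> \<open>The points above \<open>\<phi> z\<close> are precisely the
      \<open>\<phi> w\<close> with \<open>w\<close> above \<open>z\<close>, by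
      \<open>\<phi>_upset\<close> and \<open>\<phi>_back\<close>.\<close>
    also have "\<dots> \<longleftrightarrow> (\<forall>w. prime_filter H w \<longrightarrow> z \<subseteq> w \<longrightarrow> \<phi> w \<in> U \<longrightarrow> \<phi> w \<in> V)"
    proof
      assume *: "\<forall>D\<in>U - V. \<not> upset_of leX (\<phi> z) D"
      show "\<forall>w. prime_filter H w \<longrightarrow> z \<subseteq> w \<longrightarrow> \<phi> w \<in> U \<longrightarrow> \<phi> w \<in> V"
        using * \<phi>_upset[OF z] by blast
    next
      assume *: "\<forall>w. prime_filter H w \<longrightarrow> z \<subseteq> w \<longrightarrow> \<phi> w \<in> U \<longrightarrow> \<phi> w \<in> V"
      show "\<forall>D\<in>U - V. \<not> upset_of leX (\<phi> z) D"
      proof (intro ballI notI)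
        fix D assume D: "D \<in> U - V" and up: "upset_of leX (\<phi> z) D"
        have "D \<in> chains n"
          using K.carrier_subset[OF UV(1)] D points_T by auto
        then obtain w where "prime_filter H w" "z \<subseteq> w" "D = \<phi> w"
          using \<phi>_back[OF z _ up] by blast
        then show False
          using * D by blast
      qed
    qed
    also have "\<dots> \<longleftrightarrow> (h U \<Rrightarrow>\<^bsub>H\<^esub> h V) \<in> z"
      using H.imp_in_prime_filter[OF z h(1)[OF UV(1)] h(1)[OF UV(2)]] h(2)[OF UV(1)] h(2)[OF UV(2)] by auto
    finally show "h (U \<Rrightarrow>\<^bsub>coproduct n\<^esub> V) \<in> z \<longleftrightarrow> (h U \<Rrightarrow>\<^bsub>H\<^esub> h V) \<in> z" .
  qed
  have ops: "h {} = \<bottom>\<^bsub>H\<^esub>" "h (points (T n)) = \<top>\<^bsub>H\<^esub>"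
    "\<And>U V. U \<in> carrier (coproduct n) \<Longrightarrow> V \<in> carrier (coproduct n) \<Longrightarrow> h (U \<inter> V) = h U \<sqinter>\<^bsub>H\<^esub> h V"
    "\<And>U V. U \<in> carrier (coproduct n) \<Longrightarrow> V \<in> carrier (coproduct n) \<Longrightarrow> h (U \<union> V) = h U \<squnion>\<^bsub>H\<^esub> h V"
    using h(1) K.dual_algebra_closed \<phi>_chains H.prime_filterD(2,3)
    by (auto intro!: H.prime_filter_eqI simp: h(2) H.prime_filterD(5,6) points_T)
  have "h \<in> heyting_hom (coproduct n) H"
    unfolding heyting_hom_def using h(1) ops imp by (auto simp: K.dual_algebra_ops)
  moreover have "h (coproduct_map n I G i a) = f i a" if i: "i \<in> I" and a: "a \<in> carrier (G i)" for i a
  proof (rule H.prime_filter_eqI)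
    have e: "coproduct_map n I G i a \<in> carrier (coproduct n)"
      using heyting_homD(1)[OF coproduct_map_hom[OF i] a] .
    then show "h (coproduct_map n I G i a) \<in> carrier H"
      by (rule h(1))
    show "f i a \<in> carrier H"
      using heyting_homD(1)[OF f[OF i] a] .
    fix z assume z: "prime_filter H z"
    have "h (coproduct_map n I G i a) \<in> z \<longleftrightarrow> (\<forall>w\<in>up_prime H z. f i a \<in> w)"
      using h(2)[OF e z] \<phi>_chains[OF z] g_mem[OF i a] unfolding coproduct_map_eq[OF i]
      by (simp add: \<phi>_def)
    \<comment> \<open>\<open>z\<close> is the least member of \<open>up_prime H z\<close>.\<close>
    also have "\<dots> \<longleftrightarrow> f i a \<in> z"
      using z unfolding up_prime_def by blast
    finally show "h (coproduct_map n I G i a) \<in> z \<longleftrightarrow> f i a \<in> z" .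
  qed
  ultimately show thesis
    by (rule that)
qed

end

theorem theorem4p11:
  fixes n :: nat and I :: "'i set" and G :: "'i \<Rightarrow> 'a heyting"
  assumes "\<forall>i\<in>I. G i \<in> GA n"
  shows "is_GA_coproduct TYPE('c) n I G
           (dual_algebra (tensor_depth n I (\<lambda>i. dual_space (G i))))
           (coproduct_map n I G)"
proof -
  interpret heyting_family I G
    using assms GA_heyting by (intro heyting_family.intro) blast
  have "\<exists>!h. h \<in> heyting_hom (coproduct n) H \<and> h \<in> extensional (carrier (coproduct n)) \<and>
      (\<forall>i\<in>I. \<forall>a \<in> carrier (G i). h (coproduct_map n I G i a) = f i a)"
    if H: "H \<in> GA n" and f: "\<forall>i\<in>I. f i \<in> heyting_hom (G i) H" for H :: "'c heyting" and f
  proof (rule ex_ex1I)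
    obtain h where h: "h \<in> heyting_hom (coproduct n) H"
      "\<And>i a. i \<in> I \<Longrightarrow> a \<in> carrier (G i) \<Longrightarrow> h (coproduct_map n I G i a) = f i a"
      using coproduct_hom_exists[OF H, of f] f by blast
    interpret K: esakia_order "T n"
      by (rule esakia_T)
    \<comment> \<open>Being a homomorphism constrains \<open>h\<close> only on the carrier, so it is
      replaced by the extensional representative to which uniqueness refers.\<close>
    have "restrict h (carrier (coproduct n)) \<in> heyting_hom (coproduct n) H"
      using h(1) unfolding heyting_hom_def by (auto simp: K.dual_algebra_imp_closed)
    moreover have "restrict h (carrier (coproduct n)) (coproduct_map n I G i a) = f i a"
      if "i \<in> I" "a \<in> carrier (G i)" for i a
      using h(2)[OF that] heyting_homD(1)[OF coproduct_map_hom[OF that(1)] that(2)] by simp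
    ultimately show "\<exists>h. h \<in> heyting_hom (coproduct n) H \<and> h \<in> extensional (carrier (coproduct n)) \<and>
      (\<forall>i\<in>I. \<forall>a \<in> carrier (G i). h (coproduct_map n I G i a) = f i a)"
      by (intro exI[of _ "restrict h (carrier (coproduct n))"]) auto
  next
    fix h h' assume
      "h \<in> heyting_hom (coproduct n) H \<and> h \<in> extensional (carrier (coproduct n)) \<and>
        (\<forall>i\<in>I. \<forall>a \<in> carrier (G i). h (coproduct_map n I G i a) = f i a)"
      "h' \<in> heyting_hom (coproduct n) H \<and> h' \<in> extensional (carrier (coproduct n)) \<and>
        (\<forall>i\<in>I. \<forall>a \<in> carrier (G i). h' (coproduct_map n I G i a) = f i a)"
    then show "h = h'"
      using coproduct_hom_unique[OF GA_heyting[OF H], of h n h']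
      by (intro extensionalityI[of h "carrier (coproduct n)" h']) auto
  qed
  then show ?thesis
    unfolding is_GA_coproduct_def using GA_coproduct coproduct_map_hom by blast
qed

end
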